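(* (a) Let $\underline B=(B,C)$ be a precontact algebra and let $\underline X(\underline B)=(X,X_0,R)$ be its canonical 2-precontact space. Then the function $g_B$, $g_B(a)=\{\Gamma\in X\mid a\in\Gamma\}$ for $a\in B$, is a PCA-isomorphism from $(B,C)$ onto the canonical precontact algebra $(RC(X,X_0),C_{\underline X(\underline B)})$ of $\underline X(\underline B)$. The same function $g_B$ is a PCA-isomorphism between the contact algebras $(B,C^{\#})$ and $(RC(X,X_0),C_{(X,X_0)})$. The sets $RC(X)$ and $RC(X,X_0)$ coincide iff the precontact algebra $\underline B$ is complete. The algebra $\underline B$ satisfies the axiom (Cref) (resp., (Csym); (Ctr)) iff the 2-precontact space $\underline X(\underline B)$ is reflexive (resp., symmetric; transitive). The algebra $\underline B$ is connected iff $\underline X(\underline B)$ is connected. (b) There exists a bijective correspondence between the class of all, up to PCA-isomorphism, precontact algebras and the class of all, up to PCS-isomorphism, 2-precontact spaces, and likewise between the class of all, up to PCA-isomorphism, connected precontact algebras and the class of all, up to PCS-isomorphism, connected 2-precontact spaces. Namely, for every (connected) precontact algebra $\underline B$, its PCA-isomorphism class $[\underline B]$ corresponds to the PCS-isomorphism class $[\underline X(\underline B)]$ of its canonical 2-precontact space, and for every (connected) 2-precontact space $\underline X$, its PCS-isomorphism class $[\underline X]$ corresponds to the PCA-isomorphism class $[\underline B(\underline X)]$ of its canonical precontact algebra.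
   Context: Precontact algebras. A precontact algebra is a pair $(B,C)$ where $B=(B,0,1,+,\cdot,{}^* )$ is a Boolean algebra ($0=1$ allowed) and $C$ is a binary relation on $B$ such that: (C0) $aCb$ implies $a\neq0$ and $b\neq 0$; (C+) $aC(b+c)$ iff $aCb$ or $aCc$, and $(a+b)Cc$ iff $aCc$ or $bCc$. It is complete if $B$ is complete. Write $a\ll_C b$ iff not $aCb^*$. Axioms: (Cref) if $a\ne0$ then $aCa$; (Csym) if $aCb$ then $bCa$; (Ctr) if $a\ll_C c$ then there is $b$ with $a\ll_C b\ll_C c$; (Ccon) if $a\neq0,1$ then $aCa^*$ or $a^*Ca$. A contact algebra is a precontact algebra satisfying (Cref) and (Csym); a precontact algebra is connected if it satisfies (Ccon). A PCA-isomorphism $(B,C)\to(B_1,C_1)$ is a Boolean isomorphism $\varphi$ with $aCb$ iff $\varphi(a)C_1\varphi(b)$. Define $aC^{\#}b$ iff $aCb$ or $bCa$ or $a\cdot b\neq0$; then $(B,C^\#)$ is a contact algebra. A clan of $(B,C)$ is a non-empty $\Gamma\subseteq B$ such that $0\notin\Gamma$; $a\in\Gamma$, $a\le b$ imply $b\in\Gamma$; $a+b\in\Gamma$ implies $a\in\Gamma$ or $b\in\Gamma$; and $a,b\in\Gamma$ implies $aC^{\#}b$. $Clans(\underline B)$ is the set of clans, $Ult(B)\subseteq Clans(\underline B)$ the set of ultrafilters. Topology. Compactness does not include Hausdorffness. $RC(X)$ is the Boolean algebra of regular closed subsets ($F=\mathrm{cl}(\mathrm{int}F)$) of a space $X$ with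 $a+b=a\cup b$, $a^*=\mathrm{cl}(X\setminus a)$, $a\cdot b=\mathrm{cl}(\mathrm{int}(a\cap b))$, $0=\emptyset$, $1=X$. $CO(X)$ is the Boolean algebra of clopen sets. A topological pair $(X,X_0)$ is a space $X$ with a dense subspace $X_0$; $RC(X,X_0)=\{\mathrm{cl}_X(A)\mid A\in CO(X_0)\}$, a Boolean subalgebra of $RC(X)$; for $F,G\in RC(X,X_0)$, $F\,C_{(X,X_0)}\,G$ iff $F\cap G\ne\emptyset$. For $x\in X$, $\Gamma_{x,X_0}=\{F\in CO(X_0)\mid x\in \mathrm{cl}_X(F)\}$. For a relation $R$ on $X_0$ and $F,G\subseteq X_0$: $F\,C_R\,G$ iff there are $x\in F,y\in G$ with $xRy$; $(CO(X_0),C_R)$ is a precontact algebra. 2-precontact spaces. A triple $\underline X=(X,X_0,R)$ is a 2-precontact space if: (PCS1) $(X,X_0)$ is a topological pair and $X$ is $T_0$; (PCS2) $X_0$ is a Stone space (compact Hausdorff zero-dimensional) and $R$ is a closed binary relation on $X_0$ (closed in $X_0\times X_0$); (PCS3) $RC(X,X_0)$ is a closed base for $X$; (PCS4) for all $F,G\in CO(X_0)$, $\mathrm{cl}_X(F)\cap \mathrm{cl}_X(G)\neq\emptyset$ implies $F(C_R)^{\#}G$; (PCS5) for every $\Gamma\in Clans(CO(X_0),C_R)$ there is $x\in X$ with $\Gamma=\Gamma_{x,X_0}$. It is reflexive (symmetric; transitive) if $R$ is so, and connected if the space $X$ is connected. Its canonical precontact algebra is $\underline B(\underline X)=(RC(X,X_0),C_{\underline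 X})$, where $F\,C_{\underline X}\,G$ iff there are $x\in F\cap X_0$, $y\in G\cap X_0$ with $xRy$. Two 2-precontact spaces $(X,X_0,R)$, $(\widehat X,\widehat X_0,\widehat R)$ are PCS-isomorphic if there is a homeomorphism $f:X\to\widehat X$ with $f(X_0)=\widehat X_0$ and, for all $x,y\in X_0$, $xRy$ iff $f(x)\widehat Rf(y)$. The canonical 2-precontact space of $\underline B=(B,C)$ is $\underline X(\underline B)=(X,X_0,R)$, where $X=Clans(\underline B)$ with the topology having $\{g_B(a)\mid a\in B\}$ as a closed base, $X_0=Ult(B)$ with the subspace topology, and for $u,v\in X_0$, $uRv$ iff $u\times v\subseteq C$; it is a 2-precontact space. *)

theory Defs
  imports "HOL-Analysis.Analysis" "HOL-Algebra.Complete_Lattice" "HOL-Algebra.QuotRing"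
begin

section \<open>Boolean algebras with an explicit carrier\<close>

text \<open>Only the signature of \<^typ>\<open>'a ring\<close> is reused: \<open>\<oplus>\<close> is the join, \<open>\<otimes>\<close> the meet.\<close>

record 'a boolalg = "'a ring" +
  compl :: "'a \<Rightarrow> 'a"

text \<open>Huntington's axioms; the case \<open>\<zero> = \<one>\<close> is not excluded.\<close>

locale boolean_alg = comm_monoid B + abelian_monoid B
  for B :: "'a boolalg" (structure) +
  assumes compl_closed: "a \<in> carrier B \<Longrightarrow> compl B a \<in> carrier B"
    and mult_add_distrib:
      "\<lbrakk>a \<in> carrier B; b \<in> carrier B; c \<in> carrier B\<rbrakk>
        \<Longrightarrow> a \<otimes> (b \<oplus> c) = (a \<otimes> b) \<oplus> (a \<otimes> c)"
    and add_mult_distrib: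
      "\<lbrakk>a \<in> carrier B; b \<in> carrier B; c \<in> carrier B\<rbrakk>
        \<Longrightarrow> a \<oplus> (b \<otimes> c) = (a \<oplus> b) \<otimes> (a \<oplus> c)"
    and mult_compl: "a \<in> carrier B \<Longrightarrow> a \<otimes> compl B a = \<zero>"
    and add_compl: "a \<in> carrier B \<Longrightarrow> a \<oplus> compl B a = \<one>"

definition ba_le :: "'a boolalg \<Rightarrow> 'a \<Rightarrow> 'a \<Rightarrow> bool" where
  "ba_le B a b \<longleftrightarrow> a \<otimes>\<^bsub>B\<^esub> b = a"

definition ba_order :: "'a boolalg \<Rightarrow> 'a gorder" where
  "ba_order B = \<lparr>carrier = carrier B, eq = (=), le = ba_le B\<rparr>"

definition ba_complete :: "'a boolalg \<Rightarrow> bool" where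
  "ba_complete B \<longleftrightarrow> complete_lattice (ba_order B)"

definition ba_iso :: "'a boolalg \<Rightarrow> 'b boolalg \<Rightarrow> ('a \<Rightarrow> 'b) set" where
  "ba_iso A B = {h \<in> ring_iso A B. h \<zero>\<^bsub>A\<^esub> = \<zero>\<^bsub>B\<^esub> \<and>
     (\<forall>a\<in>carrier A. h (compl A a) = compl B (h a))}"

definition ba_filter :: "'a boolalg \<Rightarrow> 'a set \<Rightarrow> bool" where
  "ba_filter B u \<longleftrightarrow> u \<subseteq> carrier B \<and> u \<noteq> {} \<and>
     (\<forall>a\<in>u. \<forall>b\<in>carrier B. ba_le B a b \<longrightarrow> b \<in> u) \<and>
     (\<forall>a\<in>u. \<forall>b\<in>u. a \<otimes>\<^bsub>B\<^esub> b \<in> u)"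

definition Ult :: "'a boolalg \<Rightarrow> 'a set set" where
  "Ult B = {u. ba_filter B u \<and> \<zero>\<^bsub>B\<^esub> \<notin> u \<and>
     (\<forall>v. ba_filter B v \<and> \<zero>\<^bsub>B\<^esub> \<notin> v \<and> u \<subseteq> v \<longrightarrow> v = u)}"

section \<open>Precontact algebras\<close>

type_synonym 'a precontact = "'a boolalg \<times> ('a \<times> 'a) set"

fun precontact_algebra :: "'a precontact \<Rightarrow> bool" where
  "precontact_algebra (B, C) \<longleftrightarrow>
     boolean_alg B \<and> C \<subseteq> carrier B \<times> carrier B \<and>
     (\<forall>a b. (a, b) \<in> C \<longrightarrow> a \<noteq> \<zero>\<^bsub>B\<^esub> \<and> b \<noteq> \<zero>\<^bsub>B\<^esub>) \<and>
     (\<forall>a\<in>carrier B. \<forall>b\<in>carrier B. \<forall>c\<in>carrier B.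
        ((a, b \<oplus>\<^bsub>B\<^esub> c) \<in> C \<longleftrightarrow> (a, b) \<in> C \<or> (a, c) \<in> C) \<and>
        ((a \<oplus>\<^bsub>B\<^esub> b, c) \<in> C \<longleftrightarrow> (a, c) \<in> C \<or> (b, c) \<in> C))"

fun well_inside :: "'a precontact \<Rightarrow> 'a \<Rightarrow> 'a \<Rightarrow> bool" where
  "well_inside (B, C) a b \<longleftrightarrow> (a, compl B b) \<notin> C"

fun Cref :: "'a precontact \<Rightarrow> bool" where
  "Cref (B, C) \<longleftrightarrow> (\<forall>a\<in>carrier B. a \<noteq> \<zero>\<^bsub>B\<^esub> \<longrightarrow> (a, a) \<in> C)"

fun Csym :: "'a precontact \<Rightarrow> bool" where
  "Csym (B, C) \<longleftrightarrow> (\<forall>a\<in>carrier B. \<forall>b\<in>carrier B. (a, b) \<in> C \<longrightarrow> (b, a) \<in> C)"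

fun Ctr :: "'a precontact \<Rightarrow> bool" where
  "Ctr (B, C) \<longleftrightarrow> (\<forall>a\<in>carrier B. \<forall>c\<in>carrier B. well_inside (B, C) a c \<longrightarrow>
     (\<exists>b\<in>carrier B. well_inside (B, C) a b \<and> well_inside (B, C) b c))"

fun Ccon :: "'a precontact \<Rightarrow> bool" where
  "Ccon (B, C) \<longleftrightarrow> (\<forall>a\<in>carrier B. a \<noteq> \<zero>\<^bsub>B\<^esub> \<and> a \<noteq> \<one>\<^bsub>B\<^esub> \<longrightarrow>
     (a, compl B a) \<in> C \<or> (compl B a, a) \<in> C)"

definition contact_algebra :: "'a precontact \<Rightarrow> bool" where
  "contact_algebra A \<longleftrightarrow> precontact_algebra A \<and> Cref A \<and> Csym A"

fun pca_iso :: "'a precontact \<Rightarrow> 'b precontact \<Rightarrow> ('a \<Rightarrow> 'b) set" where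
  "pca_iso (B, C) (B', C') = {h \<in> ba_iso B B'.
     \<forall>a\<in>carrier B. \<forall>b\<in>carrier B. (a, b) \<in> C \<longleftrightarrow> (h a, h b) \<in> C'}"

definition pca_isomorphic :: "'a precontact \<Rightarrow> 'b precontact \<Rightarrow> bool" where
  "pca_isomorphic A A' \<longleftrightarrow> pca_iso A A' \<noteq> {}"

text \<open>The relation \<open>C\<^sup>#\<close>.\<close>

fun sharp :: "'a precontact \<Rightarrow> ('a \<times> 'a) set" where
  "sharp (B, C) = {(a, b) \<in> carrier B \<times> carrier B.
     (a, b) \<in> C \<or> (b, a) \<in> C \<or> a \<otimes>\<^bsub>B\<^esub> b \<noteq> \<zero>\<^bsub>B\<^esub>}"

fun Clans :: "'a precontact \<Rightarrow> 'a set set" where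
  "Clans (B, C) = {\<Gamma>. \<Gamma> \<subseteq> carrier B \<and> \<Gamma> \<noteq> {} \<and> \<zero>\<^bsub>B\<^esub> \<notin> \<Gamma> \<and>
     (\<forall>a\<in>\<Gamma>. \<forall>b\<in>carrier B. ba_le B a b \<longrightarrow> b \<in> \<Gamma>) \<and>
     (\<forall>a\<in>carrier B. \<forall>b\<in>carrier B. a \<oplus>\<^bsub>B\<^esub> b \<in> \<Gamma> \<longrightarrow> a \<in> \<Gamma> \<or> b \<in> \<Gamma>) \<and>
     (\<forall>a\<in>\<Gamma>. \<forall>b\<in>\<Gamma>. (a, b) \<in> sharp (B, C))}"

section \<open>Topological pairs\<close>

definition clopen_alg :: "'x topology \<Rightarrow> 'x set boolalg" where
  "clopen_alg T = \<lparr>carrier = {U. openin T U \<and> closedin T U},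
     mult = (\<inter>), one = topspace T, zero = {}, add = (\<union>), compl = (\<lambda>U. topspace T - U)\<rparr>"

definition RC :: "'x topology \<Rightarrow> 'x set boolalg" where
  "RC X = \<lparr>carrier = {F. F \<subseteq> topspace X \<and> F = X closure_of (X interior_of F)},
     mult = (\<lambda>a b. X closure_of (X interior_of (a \<inter> b))), one = topspace X,
     zero = {}, add = (\<union>), compl = (\<lambda>a. X closure_of (topspace X - a))\<rparr>"

definition CO_sub :: "'x topology \<Rightarrow> 'x set \<Rightarrow> 'x set boolalg" where
  "CO_sub X X0 = clopen_alg (subtopology X X0)"

definition RC_pair :: "'x topology \<Rightarrow> 'x set \<Rightarrow> 'x set boolalg" where
  "RC_pair X X0 = (RC X)\<lparr>carrier := {X closure_of A | A. A \<in> carrier (CO_sub X X0)}\<rparr>"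

text \<open>The relation \<open>C\<^bsub>(X,X0)\<^esub>\<close>.\<close>

definition pair_contact :: "'x topology \<Rightarrow> 'x set \<Rightarrow> ('x set \<times> 'x set) set" where
  "pair_contact X X0 = {(F, G) \<in> carrier (RC_pair X X0) \<times> carrier (RC_pair X X0). F \<inter> G \<noteq> {}}"

text \<open>The relation \<open>C\<^sub>R\<close>, restricted to clopen subsets of \<open>X0\<close>.\<close>

definition rel_contact ::
  "'x topology \<Rightarrow> 'x set \<Rightarrow> ('x \<times> 'x) set \<Rightarrow> ('x set \<times> 'x set) set" where
  "rel_contact X X0 R = {(F, G) \<in> carrier (CO_sub X X0) \<times> carrier (CO_sub X X0).
     \<exists>x\<in>F. \<exists>y\<in>G. (x, y) \<in> R}"

definition topological_pair :: "'x topology \<Rightarrow> 'x set \<Rightarrow> bool" where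
  "topological_pair X X0 \<longleftrightarrow> X0 \<subseteq> topspace X \<and> X closure_of X0 = topspace X"

definition zero_dimensional :: "'x topology \<Rightarrow> bool" where
  "zero_dimensional T \<longleftrightarrow> (\<forall>U x. openin T U \<and> x \<in> U \<longrightarrow>
     (\<exists>V. openin T V \<and> closedin T V \<and> x \<in> V \<and> V \<subseteq> U))"

definition Stone_space :: "'x topology \<Rightarrow> bool" where
  "Stone_space T \<longleftrightarrow> compact_space T \<and> Hausdorff_space T \<and> zero_dimensional T"

text \<open>The intersection with the whole space makes the empty intersection the whole space.\<close>

definition closed_base :: "'x topology \<Rightarrow> 'x set set \<Rightarrow> bool" where
  "closed_base X \<B> \<longleftrightarrow> (\<forall>F\<in>\<B>. closedin X F) \<and>
     (\<forall>S. closedin X S \<longrightarrow> (\<exists>\<G>\<subseteq>\<B>. S = topspace X \<inter> \<Inter>\<G>))"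

definition point_clan :: "'x topology \<Rightarrow> 'x set \<Rightarrow> 'x \<Rightarrow> 'x set set" where
  "point_clan X X0 x = {F \<in> carrier (CO_sub X X0). x \<in> X closure_of F}"

section \<open>2-precontact spaces\<close>

type_synonym 'x pcspace = "'x topology \<times> 'x set \<times> ('x \<times> 'x) set"

fun precontact_space :: "'x pcspace \<Rightarrow> bool" where
  "precontact_space (X, X0, R) \<longleftrightarrow>
     topological_pair X X0 \<and> t0_space X \<and>
     Stone_space (subtopology X X0) \<and>
     closedin (prod_topology (subtopology X X0) (subtopology X X0)) R \<and>
     closed_base X (carrier (RC_pair X X0)) \<and>
     (\<forall>F\<in>carrier (CO_sub X X0). \<forall>G\<in>carrier (CO_sub X X0).
        X closure_of F \<inter> X closure_of G \<noteq> {} \<longrightarrow>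
        (F, G) \<in> sharp (CO_sub X X0, rel_contact X X0 R)) \<and>
     (\<forall>\<Gamma>\<in>Clans (CO_sub X X0, rel_contact X X0 R). \<exists>x\<in>topspace X. \<Gamma> = point_clan X X0 x)"

fun pcs_reflexive :: "'x pcspace \<Rightarrow> bool" where
  "pcs_reflexive (X, X0, R) \<longleftrightarrow> refl_on X0 R"

fun pcs_symmetric :: "'x pcspace \<Rightarrow> bool" where
  "pcs_symmetric (X, X0, R) \<longleftrightarrow> sym R"

fun pcs_transitive :: "'x pcspace \<Rightarrow> bool" where
  "pcs_transitive (X, X0, R) \<longleftrightarrow> trans R"

fun pcs_connected :: "'x pcspace \<Rightarrow> bool" where
  "pcs_connected (X, X0, R) \<longleftrightarrow> connected_space X"

fun pcs_iso :: "'x pcspace \<Rightarrow> 'y pcspace \<Rightarrow> ('x \<Rightarrow> 'y) set" where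
  "pcs_iso (X, X0, R) (Y, Y0, S) = {f. homeomorphic_map X Y f \<and> f ` X0 = Y0 \<and>
     (\<forall>x\<in>X0. \<forall>y\<in>X0. (x, y) \<in> R \<longleftrightarrow> (f x, f y) \<in> S)}"

definition pcs_isomorphic :: "'x pcspace \<Rightarrow> 'y pcspace \<Rightarrow> bool" where
  "pcs_isomorphic X Y \<longleftrightarrow> pcs_iso X Y \<noteq> {}"

fun canonical_algebra :: "'x pcspace \<Rightarrow> 'x set precontact" where
  "canonical_algebra (X, X0, R) = (RC_pair X X0,
     {(F, G) \<in> carrier (RC_pair X X0) \<times> carrier (RC_pair X X0).
        \<exists>x\<in>F \<inter> X0. \<exists>y\<in>G \<inter> X0. (x, y) \<in> R})"

definition gmap :: "'a precontact \<Rightarrow> 'a \<Rightarrow> 'a set set" where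
  "gmap A a = {\<Gamma> \<in> Clans A. a \<in> \<Gamma>}"

text \<open>The sets \<^term>\<open>gmap (B, C) a\<close> form a closed base, i.e. their complements form a base of
  open sets; as \<^term>\<open>gmap (B, C) \<zero>\<^bsub>B\<^esub>\<close> is empty, the whole space is the set of all clans.\<close>

fun clan_topology :: "'a precontact \<Rightarrow> 'a set topology" where
  "clan_topology (B, C) =
     topology (arbitrary union_of (\<lambda>U. \<exists>a\<in>carrier B. U = Clans (B, C) - gmap (B, C) a))"

fun canonical_space :: "'a precontact \<Rightarrow> 'a set pcspace" where
  "canonical_space (B, C) = (clan_topology (B, C), Ult B,
     {(u, v) \<in> Ult B \<times> Ult B. u \<times> v \<subseteq> C})"

end

theory Submission
  imports Defs
begin

text \<open>
  By the prime filter theorem, \<open>a C b\<close> holds iff some ultrafilters \<open>u \<ni> a\<close> and \<open>v \<ni> b\<close> satisfy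
  \<open>u \<times> v \<subseteq> C\<close>; the union of such a pair is a clan, so \<open>g a\<close> meets \<open>g b\<close> iff \<open>a C\<^sup># b\<close>. The Stone
  map \<open>s\<close> is an isomorphism of precontact algebras from \<open>(B, C)\<close> onto the clopen algebra of the set of ultrafilters,
  and \<open>g a\<close> is the closure of \<open>s a\<close> in the space of clans. For every topological pair, taking closures is an
  isomorphism from the clopen algebra of the dense subspace onto \<open>RC(X, X0)\<close>; composing it with the Stone map
  shows that \<open>g\<close> is an isomorphism. Conversely, the points of a 2-precontact space are in bijection with the
  clans of its clopen algebra, and this bijection matches the closed bases, hence it is a homeomorphism.
\<close>

section \<open>Boolean algebras and ultrafilters\<close>

text \<open>The recurring device is the grill: an upward closed set without zero that contains a
  join only if it contains one of the summands. The complement of a grill is an ideal, so each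
  member of a grill lies in an ultrafilter inside the grill. Besides producing related ultrafilters,
  well chosen grills give compactness of the space of ultrafilters and show that its clopen sets are
  Stone sets. A second obstacle is that \<open>RC_pair X X0\<close> is only a record with the
  operations of \<open>RC X\<close>. Its Boolean and contact laws are transported from the clopen
  algebra along the closure map. Equality after a round trip is out of reach, since the points of
  the canonical space of the canonical algebra are sets of sets of points; all comparisons go
  through explicit isomorphisms between different types.\<close>

context boolean_alg
begin

text \<open>Huntington's axioms contain no idempotence. Distributing \<open>a\<close> over
  \<open>a \<oplus> compl B a = \<one>\<close> produces it, and the lattice order rests on
  it.\<close>

lemma meet_idem: "a \<in> carrier B \<Longrightarrow> a \<otimes> a = a"
  using mult_add_distrib[of a a "compl B a"]
  by (simp add: add_compl mult_compl compl_closed)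

lemma join_idem: "a \<in> carrier B \<Longrightarrow> a \<oplus> a = a"
  using add_mult_distrib[of a a "compl B a"]
  by (simp add: add_compl mult_compl compl_closed)

lemma meet_zero: "a \<in> carrier B \<Longrightarrow> a \<otimes> \<zero> = \<zero>"
  using m_assoc[of a a "compl B a"]
  by (simp add: meet_idem mult_compl compl_closed)

lemma join_one: "a \<in> carrier B \<Longrightarrow> a \<oplus> \<one> = \<one>"
  using a_assoc[of a a "compl B a"]
  by (simp add: join_idem add_compl compl_closed)

lemma meet_absorb: "a \<in> carrier B \<Longrightarrow> b \<in> carrier B \<Longrightarrow> a \<otimes> (a \<oplus> b) = a"
  using add_mult_distrib[of a \<zero> b] by (simp add: meet_zero m_comm[of \<zero> b])

lemma join_absorb: "a \<in> carrier B \<Longrightarrow> b \<in> carrier B \<Longrightarrow> a \<oplus> (a \<otimes> b) = a"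
  using mult_add_distrib[of a \<one> b] by (simp add: join_one a_comm[of \<one> b])

lemma le_refl: "a \<in> carrier B \<Longrightarrow> ba_le B a a"
  by (simp add: ba_le_def meet_idem)

lemma le_trans:
  "\<lbrakk>ba_le B a b; ba_le B b c; a \<in> carrier B; b \<in> carrier B; c \<in> carrier B\<rbrakk> \<Longrightarrow> ba_le B a c"
  unfolding ba_le_def by (metis m_assoc)

lemma le_antisym:
  "\<lbrakk>ba_le B a b; ba_le B b a; a \<in> carrier B; b \<in> carrier B\<rbrakk> \<Longrightarrow> a = b"
  unfolding ba_le_def by (metis m_comm)

lemma le_one: "a \<in> carrier B \<Longrightarrow> ba_le B a \<one>"
  by (simp add: ba_le_def)

lemma le_zero: "a \<in> carrier B \<Longrightarrow> ba_le B a \<zero> \<Longrightarrow> a = \<zero>"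
  by (simp add: ba_le_def meet_zero)

lemma meet_le: "a \<in> carrier B \<Longrightarrow> b \<in> carrier B \<Longrightarrow> ba_le B (a \<otimes> b) a"
  unfolding ba_le_def by (metis m_assoc m_comm meet_idem)

lemma meet_le': "a \<in> carrier B \<Longrightarrow> b \<in> carrier B \<Longrightarrow> ba_le B (a \<otimes> b) b"
  using meet_le[of b a] by (simp add: m_comm)

lemma le_meet:
  "\<lbrakk>ba_le B c a; ba_le B c b; a \<in> carrier B; b \<in> carrier B; c \<in> carrier B\<rbrakk> \<Longrightarrow> ba_le B c (a \<otimes> b)"
  unfolding ba_le_def by (metis m_assoc)

lemma le_join: "a \<in> carrier B \<Longrightarrow> b \<in> carrier B \<Longrightarrow> ba_le B a (a \<oplus> b)"
  by (simp add: ba_le_def meet_absorb)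

lemma le_join': "a \<in> carrier B \<Longrightarrow> b \<in> carrier B \<Longrightarrow> ba_le B b (a \<oplus> b)"
  using le_join[of b a] by (simp add: a_comm)

lemma le_join_eq: "a \<in> carrier B \<Longrightarrow> b \<in> carrier B \<Longrightarrow> ba_le B a b \<Longrightarrow> a \<oplus> b = b"
  unfolding ba_le_def by (metis a_comm join_absorb m_comm)

lemma meet_mono:
  assumes "ba_le B a c" "ba_le B b d" "a \<in> carrier B" "b \<in> carrier B" "c \<in> carrier B" "d \<in> carrier B"
  shows "ba_le B (a \<otimes> b) (c \<otimes> d)"
  by (rule le_meet) (use assms le_trans[OF meet_le] le_trans[OF meet_le'] in auto)

section \<open>Filters and the prime filter theorem\<close>

lemma filterD:
  assumes "ba_filter B F"
  shows "F \<subseteq> carrier B" "a \<in> F \<Longrightarrow> b \<in> carrier B \<Longrightarrow> ba_le B a b \<Longrightarrow> b \<in> F"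
    "a \<in> F \<Longrightarrow> b \<in> F \<Longrightarrow> a \<otimes> b \<in> F" "\<one> \<in> F"
proof -
  note F = assms[unfolded ba_filter_def]
  show "F \<subseteq> carrier B" "a \<in> F \<Longrightarrow> b \<in> carrier B \<Longrightarrow> ba_le B a b \<Longrightarrow> b \<in> F"
    "a \<in> F \<Longrightarrow> b \<in> F \<Longrightarrow> a \<otimes> b \<in> F"
    using F by blast+
  obtain c where "c \<in> F" using F by blast
  then show "\<one> \<in> F" using F le_one by blast
qed

lemma principal_filter:
  assumes "a \<in> carrier B" shows "ba_filter B {x \<in> carrier B. ba_le B a x}"
  unfolding ba_filter_def using assms le_refl le_meet le_trans by blast

text \<open>The filter generated by \<open>F\<close> and \<open>a\<close>, the enlargement that the
  maximality argument tests. It is closed under meets because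
  \<open>(y1 \<otimes> y2) \<otimes> a\<close> lies below both \<open>y1 \<otimes> a\<close> and
  \<open>y2 \<otimes> a\<close>.\<close>

lemma filter_insert:
  assumes F: "ba_filter B F" and a: "a \<in> carrier B"
  defines "F' \<equiv> {x \<in> carrier B. \<exists>y\<in>F. ba_le B (y \<otimes> a) x}"
  shows "ba_filter B F'" "F \<subseteq> F'" "a \<in> F'"
proof -
  note FD = filterD[OF F]
  have "x1 \<otimes> x2 \<in> F'" if "x1 \<in> F'" "x2 \<in> F'" for x1 x2
  proof -
    from that obtain y1 y2 where y: "y1 \<in> F" "y2 \<in> F" "ba_le B (y1 \<otimes> a) x1" "ba_le B (y2 \<otimes> a) x2"
      and x: "x1 \<in> carrier B" "x2 \<in> carrier B" by (auto simp: F'_def)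
    have yc: "y1 \<in> carrier B" "y2 \<in> carrier B" using y FD(1) by auto
    have "ba_le B ((y1 \<otimes> y2) \<otimes> a) (y1 \<otimes> a)" "ba_le B ((y1 \<otimes> y2) \<otimes> a) (y2 \<otimes> a)"
      by (rule meet_mono; use a yc meet_le meet_le' le_refl in simp)+
    then have "ba_le B ((y1 \<otimes> y2) \<otimes> a) x1" "ba_le B ((y1 \<otimes> y2) \<otimes> a) x2"
      using le_trans y(3,4) a yc x by (meson m_closed)+
    then have "ba_le B ((y1 \<otimes> y2) \<otimes> a) (x1 \<otimes> x2)"
      using le_meet a yc x by simp
    then show ?thesis using FD(3)[OF y(1,2)] x by (auto simp: F'_def)
  qed
  moreover have "F \<subseteq> F'" using FD(1) meet_le a by (auto simp: F'_def)
  moreover have "x' \<in> F'" if "x \<in> F'" "x' \<in> carrier B" "ba_le B x x'" for x x'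
    proof -
    from that obtain y where "y \<in> F" "ba_le B (y \<otimes> a) x" "x \<in> carrier B" by (auto simp: F'_def)
    then show ?thesis using that FD(1) a le_trans[of "y \<otimes> a" x x'] by (auto simp: F'_def)
  qed
  moreover have "F' \<subseteq> carrier B" by (auto simp: F'_def)
  ultimately show "ba_filter B F'" "F \<subseteq> F'"
    using FD(4) unfolding ba_filter_def by blast+
  show "a \<in> F'" using a FD(1,4) le_refl unfolding F'_def by force
qed

text \<open>The prime filter theorem; the set \<open>G\<close> is the complement of the ideal to be avoided.\<close>

lemma prime_filter:
  assumes F: "ba_filter B F" and FG: "F \<subseteq> G"
    and zero: "\<zero> \<notin> G"
    and up: "\<And>a b. \<lbrakk>a \<in> G; a \<in> carrier B; b \<in> carrier B; ba_le B a b\<rbrakk> \<Longrightarrow> b \<in> G"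
    and prime: "\<And>a b. \<lbrakk>a \<in> carrier B; b \<in> carrier B; a \<oplus> b \<in> G\<rbrakk> \<Longrightarrow> a \<in> G \<or> b \<in> G"
  obtains u where "ba_filter B u" "\<zero> \<notin> u" "\<And>a. a \<in> carrier B \<Longrightarrow> a \<in> u \<or> compl B a \<in> u"
    "F \<subseteq> u" "u \<subseteq> G"
proof -
  define P where "P = {u. ba_filter B u \<and> F \<subseteq> u \<and> u \<subseteq> G}"
  have "\<exists>M\<in>P. \<forall>X\<in>P. M \<subseteq> X \<longrightarrow> X = M"
  proof (rule subset_Zorn_nonempty)
    show "P \<noteq> {}" using F FG unfolding P_def by blast
    fix K assume K: "K \<noteq> {}" "subset.chain P K"
    have KP: "K \<subseteq> P" and lin: "\<And>x y. x \<in> K \<Longrightarrow> y \<in> K \<Longrightarrow> x \<subseteq> y \<or> y \<subseteq> x"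
      using K(2) by (auto simp: subset_chain_def)
    have fK: "ba_filter B k" if "k \<in> K" for k using KP that by (auto simp: P_def)
    have "ba_filter B (\<Union>K)"
      unfolding ba_filter_def
    proof (intro conjI ballI impI)
      show "\<Union>K \<subseteq> carrier B" using filterD(1)[OF fK] by blast
      show "\<Union>K \<noteq> {}" using K(1) filterD(4)[OF fK] by blast
      show "b \<in> \<Union>K" if "a \<in> \<Union>K" "b \<in> carrier B" "ba_le B a b" for a b
        using that filterD(2)[OF fK] by blast
      show "a \<otimes> b \<in> \<Union>K" if "a \<in> \<Union>K" "b \<in> \<Union>K" for a b
      proof -
        from that obtain j k where jk: "a \<in> j" "j \<in> K" "b \<in> k" "k \<in> K" by blast
        with lin[of j k] have "a \<in> j \<and> b \<in> j \<or> a \<in> k \<and> b \<in> k" by blast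
        then show ?thesis using jk filterD(3)[OF fK] by blast
      qed
    qed
    then show "\<Union>K \<in> P" using KP K(1) by (auto simp: P_def)
  qed
  then obtain u where u: "ba_filter B u" "F \<subseteq> u" "u \<subseteq> G"
    and max: "\<And>v. ba_filter B v \<Longrightarrow> u \<subseteq> v \<Longrightarrow> v \<subseteq> G \<Longrightarrow> v = u" by (auto simp: P_def)
  note uD = filterD[OF u(1)]
  \<comment> \<open>By maximality, enlarging \<open>u\<close> by an outside element must leave
    \<open>G\<close>. Since \<open>G\<close> is upward closed, the escape already shows at some
    \<open>y \<otimes> a\<close>.\<close>
  have out: "\<exists>y\<in>u. y \<otimes> a \<notin> G" if a: "a \<in> carrier B" "a \<notin> u" for a
  proof (rule ccontr)
    assume *: "\<not> ?thesis"
    then have "{x \<in> carrier B. \<exists>y\<in>u. ba_le B (y \<otimes> a) x} \<subseteq> G"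
      using up uD(1) a(1) m_closed by blast
    with max[OF filter_insert(1,2)[OF u(1) a(1)]] filter_insert(3)[OF u(1) a(1)] a(2)
    show False by blast
  qed
  have "a \<in> u \<or> compl B a \<in> u" if a: "a \<in> carrier B" for a
  proof (rule ccontr)
    assume "\<not> ?thesis"
    then obtain y z where y: "y \<in> u" "y \<otimes> a \<notin> G" and z: "z \<in> u" "z \<otimes> compl B a \<notin> G"
      using out a compl_closed by meson
    have c: "y \<in> carrier B" "z \<in> carrier B" using y z uD(1) by auto
    \<comment> \<open>One element of \<open>u\<close> below both witnesses. It splits as
      \<open>w \<otimes> a \<oplus> w \<otimes> compl B a\<close>; primeness of \<open>G\<close>
      keeps one summand in \<open>G\<close>, whereas each lies below an element outside
      \<open>G\<close>.\<close>
    define w where "w = y \<otimes> z"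
    have w: "w \<in> u" "w \<in> carrier B" using y z c uD(3) by (auto simp: w_def)
    have "w \<otimes> a \<oplus> w \<otimes> compl B a = w"
      using w a mult_add_distrib[of w a "compl B a"] by (simp add: compl_closed add_compl)
    then have "w \<otimes> a \<in> G \<or> w \<otimes> compl B a \<in> G"
      using prime[of "w \<otimes> a" "w \<otimes> compl B a"] w u(3) a compl_closed by auto
    moreover have "ba_le B (w \<otimes> a) (y \<otimes> a)" "ba_le B (w \<otimes> compl B a) (z \<otimes> compl B a)"
      using c a compl_closed unfolding w_def
      by (auto intro!: meet_mono meet_le meet_le' le_refl)
    ultimately show False using up y z w c a compl_closed by (meson m_closed)
  qed
  then show ?thesis using that u zero by blast
qed

section \<open>Ultrafilters and the laws they satisfy\<close>

lemma nonzero_grill: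
  "\<zero> \<notin> carrier B - {\<zero>}"
  "\<lbrakk>a \<in> carrier B - {\<zero>}; a \<in> carrier B; b \<in> carrier B; ba_le B a b\<rbrakk> \<Longrightarrow> b \<in> carrier B - {\<zero>}"
  "\<lbrakk>a \<in> carrier B; b \<in> carrier B; a \<oplus> b \<in> carrier B - {\<zero>}\<rbrakk>
    \<Longrightarrow> a \<in> carrier B - {\<zero>} \<or> b \<in> carrier B - {\<zero>}"
  using le_zero[of a] by auto

lemma mem_Ult_iff:
  "u \<in> Ult B \<longleftrightarrow> ba_filter B u \<and> \<zero> \<notin> u \<and> (\<forall>a\<in>carrier B. a \<in> u \<or> compl B a \<in> u)"
proof
  assume u: "u \<in> Ult B"
  then have f: "ba_filter B u" "\<zero> \<notin> u" by (auto simp: Ult_def)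
  \<comment> \<open>The non-zero elements form the largest grill, so here
    \<open>prime_filter\<close> is the ordinary ultrafilter theorem; maximality of \<open>u\<close>
    then identifies \<open>v\<close> with it.\<close>
  obtain v where "ba_filter B v" "\<zero> \<notin> v" "\<forall>a\<in>carrier B. a \<in> v \<or> compl B a \<in> v" "u \<subseteq> v"
  proof (rule prime_filter[OF f(1), of "carrier B - {\<zero>}"])
    show "u \<subseteq> carrier B - {\<zero>}" using f filterD(1) by auto
  qed (use nonzero_grill in \<open>blast+\<close>)
  with u show "ba_filter B u \<and> \<zero> \<notin> u \<and> (\<forall>a\<in>carrier B. a \<in> u \<or> compl B a \<in> u)"
    by (auto simp: Ult_def)
next
  assume u: "ba_filter B u \<and> \<zero> \<notin> u \<and> (\<forall>a\<in>carrier B. a \<in> u \<or> compl B a \<in> u)"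
  have "v = u" if v: "ba_filter B v" "\<zero> \<notin> v" "u \<subseteq> v" for v
  proof -
    \<comment> \<open>An element of \<open>v\<close> outside \<open>u\<close> would have its
      complement in \<open>u\<close>, so \<open>v\<close> would contain their meet, which is
      zero.\<close>
    have "a \<in> u" if "a \<in> v" for a
      using that u v filterD(1,3)[OF v(1)] mult_compl by (metis subsetD)
    then show ?thesis using v by auto
  qed
  then show "u \<in> Ult B" using u by (auto simp: Ult_def)
qed

text \<open>The principal filter of \<open>a\<close> stays inside \<open>G\<close> because
  \<open>G\<close> is upward closed, so \<open>prime_filter\<close> applies. The premises say that
  \<open>G\<close> is a grill; several later proofs reduce to choosing one.\<close>

lemma grill_ultrafilter:
  assumes "a \<in> G" "a \<in> carrier B" "\<zero> \<notin> G"
    and "\<And>a b. \<lbrakk>a \<in> G; a \<in> carrier B; b \<in> carrier B; ba_le B a b\<rbrakk> \<Longrightarrow> b \<in> G"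
    and "\<And>a b. \<lbrakk>a \<in> carrier B; b \<in> carrier B; a \<oplus> b \<in> G\<rbrakk> \<Longrightarrow> a \<in> G \<or> b \<in> G"
  obtains u where "u \<in> Ult B" "a \<in> u" "u \<subseteq> G"
proof -
  obtain u where "u \<in> Ult B" "{x \<in> carrier B. ba_le B a x} \<subseteq> u" "u \<subseteq> G"
    by (rule prime_filter[OF principal_filter[OF assms(2)], of G])
      (use assms in \<open>auto simp: mem_Ult_iff\<close>)
  then show ?thesis using that le_refl assms(2) by blast
qed

lemma ultrafilter_exists:
  assumes "a \<in> carrier B" "a \<noteq> \<zero>" obtains u where "u \<in> Ult B" "a \<in> u"
  by (rule grill_ultrafilter[OF _ _ nonzero_grill]) (use assms in auto)

lemma Ult_subset: "u \<in> Ult B \<Longrightarrow> u \<subseteq> carrier B"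
  by (simp add: mem_Ult_iff ba_filter_def)

lemma Ult_zero: "u \<in> Ult B \<Longrightarrow> \<zero> \<notin> u"
  by (simp add: mem_Ult_iff)

lemma Ult_one: "u \<in> Ult B \<Longrightarrow> \<one> \<in> u"
  by (simp add: mem_Ult_iff filterD)

lemma Ult_le: "\<lbrakk>u \<in> Ult B; a \<in> u; b \<in> carrier B; ba_le B a b\<rbrakk> \<Longrightarrow> b \<in> u"
  by (meson mem_Ult_iff filterD)

lemma Ult_meet:
  assumes "u \<in> Ult B" "a \<in> carrier B" "b \<in> carrier B"
  shows "a \<otimes> b \<in> u \<longleftrightarrow> a \<in> u \<and> b \<in> u"
  using assms by (meson Ult_le mem_Ult_iff filterD(3) meet_le meet_le')

lemma Ult_compl:
  assumes "u \<in> Ult B" "a \<in> carrier B" shows "compl B a \<in> u \<longleftrightarrow> a \<notin> u"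
  using assms by (metis Ult_meet Ult_zero compl_closed mem_Ult_iff mult_compl)

text \<open>For the primeness direction, meet \<open>a \<oplus> b\<close> with
  \<open>compl B a\<close>: what is left lies below \<open>b\<close>.\<close>

lemma Ult_join:
  assumes u: "u \<in> Ult B" and a: "a \<in> carrier B" and b: "b \<in> carrier B"
  shows "a \<oplus> b \<in> u \<longleftrightarrow> a \<in> u \<or> b \<in> u"
proof -
  have False if "a \<oplus> b \<in> u" "a \<notin> u" "b \<notin> u"
  proof -
    have "compl B a \<otimes> (a \<oplus> b) = compl B a \<otimes> b"
      using a b by (simp add: mult_add_distrib compl_closed m_comm[of _ a] mult_compl)
    then show False using that u a b
      by (metis Ult_compl Ult_meet a_closed compl_closed)
  qed
  then show ?thesis using u a b by (meson Ult_le a_closed le_join le_join')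
qed

text \<open>If \<open>a \<otimes> compl B b\<close> were non-zero, an ultrafilter through it would
  contain \<open>a\<close> and not \<open>b\<close>. Identities can then be checked inside one
  ultrafilter, where \<open>Ult_simps\<close> turns the operations into connectives.\<close>

lemma le_iff_Ult:
  assumes a: "a \<in> carrier B" and b: "b \<in> carrier B"
  shows "ba_le B a b \<longleftrightarrow> (\<forall>u\<in>Ult B. a \<in> u \<longrightarrow> b \<in> u)"
proof
  assume "\<forall>u\<in>Ult B. a \<in> u \<longrightarrow> b \<in> u"
  then have "a \<otimes> compl B b = \<zero>"
    using ultrafilter_exists[of "a \<otimes> compl B b"] a b by (metis Ult_compl Ult_meet compl_closed m_closed)
  moreover have "a = a \<otimes> b \<oplus> a \<otimes> compl B b"
    using a b by (metis add_compl compl_closed mult_add_distrib r_one)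
  ultimately show "ba_le B a b" using a b by (simp add: ba_le_def)
qed (use Ult_le b in blast)

lemma eq_iff_Ult:
  assumes a: "a \<in> carrier B" and b: "b \<in> carrier B"
  shows "a = b \<longleftrightarrow> (\<forall>u\<in>Ult B. a \<in> u \<longleftrightarrow> b \<in> u)"
  using assms le_antisym le_iff_Ult by metis

lemmas Ult_simps = Ult_meet Ult_join Ult_compl Ult_zero Ult_one compl_closed

lemma compl_compl: "a \<in> carrier B \<Longrightarrow> compl B (compl B a) = a"
  by (simp add: eq_iff_Ult Ult_simps)

lemma compl_one: "compl B \<one> = \<zero>"
  by (simp add: eq_iff_Ult Ult_simps)

end

section \<open>Precontact algebras\<close>

locale precontact = boolean_alg +
  fixes C :: "('a \<times> 'a) set"
  assumes C_subset: "C \<subseteq> carrier B \<times> carrier B"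
    and C_nonzero: "(a, b) \<in> C \<Longrightarrow> a \<noteq> \<zero> \<and> b \<noteq> \<zero>"
    and C_join_right: "\<lbrakk>a \<in> carrier B; b \<in> carrier B; c \<in> carrier B\<rbrakk>
      \<Longrightarrow> (a, b \<oplus> c) \<in> C \<longleftrightarrow> (a, b) \<in> C \<or> (a, c) \<in> C"
    and C_join_left: "\<lbrakk>a \<in> carrier B; b \<in> carrier B; c \<in> carrier B\<rbrakk>
      \<Longrightarrow> (a \<oplus> b, c) \<in> C \<longleftrightarrow> (a, c) \<in> C \<or> (b, c) \<in> C"

declare Clans.simps [simp del] clan_topology.simps [simp del]

lemma precontact_algebra_iff: "precontact_algebra (B, C) \<longleftrightarrow> precontact B C"
  by (auto simp: precontact_def precontact_axioms_def)

text \<open>Names the relation of \<open>canonical_space\<close>, so that it can be studied before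
  any topology enters.\<close>

definition ult_rel :: "'a boolalg \<Rightarrow> ('a \<times> 'a) set \<Rightarrow> ('a set \<times> 'a set) set" where
  "ult_rel B C = {(u, v) \<in> Ult B \<times> Ult B. u \<times> v \<subseteq> C}"

lemma canonical_space_eq: "canonical_space (B, C) = (clan_topology (B, C), Ult B, ult_rel B C)"
  by (simp add: ult_rel_def)

context precontact
begin

text \<open>Exchanging the sides of \<open>C\<close> gives the left-hand version of the extension
  lemma.\<close>

lemma converse_precontact: "precontact B (C\<inverse>)"
  by unfold_locales (use C_subset C_nonzero C_join_right C_join_left in auto)

lemma C_carrier: "(a, b) \<in> C \<Longrightarrow> a \<in> carrier B" "(a, b) \<in> C \<Longrightarrow> b \<in> carrier B"
  using C_subset by auto

lemma C_mono_right:
  assumes "(a, b) \<in> C" "ba_le B b c" "c \<in> carrier B" shows "(a, c) \<in> C"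
  using assms C_join_right[of a b c] le_join_eq[of b c] C_carrier by auto

lemma C_mono_left:
  assumes "(a, b) \<in> C" "ba_le B a c" "c \<in> carrier B" shows "(c, b) \<in> C"
  using assms C_join_left[of a c b] le_join_eq[of a c] C_carrier by auto

text \<open>The elements in contact with all of \<open>u\<close> form a grill. If \<open>a\<close>
  in \<open>u\<close> misses \<open>c\<close> and \<open>a'\<close> in \<open>u\<close> misses
  \<open>d\<close>, then \<open>a \<otimes> a'\<close> in \<open>u\<close> misses both, hence misses
  \<open>c \<oplus> d\<close>.\<close>

lemma ult_rel_extend:
  assumes u: "u \<in> Ult B" and b: "b \<in> carrier B" and ub: "\<And>a. a \<in> u \<Longrightarrow> (a, b) \<in> C"
  obtains v where "v \<in> Ult B" "b \<in> v" "u \<times> v \<subseteq> C"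
proof (rule grill_ultrafilter[of b "{c \<in> carrier B. \<forall>a\<in>u. (a, c) \<in> C}"])
  show "\<zero> \<notin> {c \<in> carrier B. \<forall>a\<in>u. (a, c) \<in> C}"
    using Ult_one[OF u] C_nonzero by blast
  fix c d assume cd: "c \<in> carrier B" "d \<in> carrier B" "c \<oplus> d \<in> {c \<in> carrier B. \<forall>a\<in>u. (a, c) \<in> C}"
  have False if a: "a \<in> u" "(a, c) \<notin> C" and a': "a' \<in> u" "(a', d) \<notin> C" for a a'
  proof -
    have ac: "a \<in> carrier B" "a' \<in> carrier B" using a a' Ult_subset[OF u] by auto
    then have "a \<otimes> a' \<in> u" using a a' u Ult_meet by auto
    then have "(a \<otimes> a', c) \<in> C \<or> (a \<otimes> a', d) \<in> C" using cd ac C_join_right by auto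
    then show False using a a' ac C_mono_left meet_le meet_le' by blast
  qed
  then show "c \<in> {c \<in> carrier B. \<forall>a\<in>u. (a, c) \<in> C} \<or> d \<in> {c \<in> carrier B. \<forall>a\<in>u. (a, c) \<in> C}"
    using cd by blast
next
  show "b \<in> {c \<in> carrier B. \<forall>a\<in>u. (a, c) \<in> C}" "b \<in> carrier B" using b ub by auto
  show "thesis" if "v \<in> Ult B" "b \<in> v" "v \<subseteq> {c \<in> carrier B. \<forall>a\<in>u. (a, c) \<in> C}" for v
    using \<open>\<And>v. v \<in> Ult B \<Longrightarrow> b \<in> v \<Longrightarrow> u \<times> v \<subseteq> C \<Longrightarrow> thesis\<close> that by blast
qed (auto intro: C_mono_right)

lemma ult_rel_extend':
  assumes v: "v \<in> Ult B" and a: "a \<in> carrier B" and av: "\<And>b. b \<in> v \<Longrightarrow> (a, b) \<in> C"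
  obtains u where "u \<in> Ult B" "a \<in> u" "u \<times> v \<subseteq> C"
proof -
  interpret conv: precontact B "C\<inverse>" by (rule converse_precontact)
  show ?thesis by (rule conv.ult_rel_extend[OF v a]) (use av that in blast)+
qed

text \<open>The two ultrafilters are chosen one after the other. With \<open>b\<close> fixed, the
  elements in contact with it form a grill containing \<open>a\<close>; an ultrafilter
  \<open>u\<close> inside that grill then has a partner on the right by
  \<open>ult_rel_extend\<close>.\<close>

lemma ult_rel_exists:
  assumes "(a, b) \<in> C"
  obtains u v where "(u, v) \<in> ult_rel B C" "a \<in> u" "b \<in> v"
proof -
  obtain u where "u \<in> Ult B" "a \<in> u" "u \<subseteq> {x \<in> carrier B. (x, b) \<in> C}"
  proof (rule grill_ultrafilter[of a "{x \<in> carrier B. (x, b) \<in> C}"])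
    show "a \<in> {x \<in> carrier B. (x, b) \<in> C}" "a \<in> carrier B" using assms C_carrier by auto
    show "\<zero> \<notin> {x \<in> carrier B. (x, b) \<in> C}" using C_nonzero by auto
  qed (use C_join_left C_carrier(2)[OF assms] in \<open>auto intro: C_mono_left\<close>)
  then show ?thesis
    using ult_rel_extend[of u b] C_carrier(2)[OF assms] that unfolding ult_rel_def by blast
qed

lemma C_iff_ult_rel:
  assumes "a \<in> carrier B" "b \<in> carrier B"
  shows "(a, b) \<in> C \<longleftrightarrow> (\<exists>(u, v) \<in> ult_rel B C. a \<in> u \<and> b \<in> v)"
proof
  assume "(a, b) \<in> C"
  then show "\<exists>(u, v) \<in> ult_rel B C. a \<in> u \<and> b \<in> v" by (rule ult_rel_exists) blast
qed (auto simp: ult_rel_def)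

lemma ult_rel_Ult: "(u, v) \<in> ult_rel B C \<Longrightarrow> u \<in> Ult B \<and> v \<in> Ult B"
  by (auto simp: ult_rel_def)

section \<open>The axioms read off the relation between ultrafilters\<close>

lemma Cref_iff: "Cref (B, C) \<longleftrightarrow> refl_on (Ult B) (ult_rel B C)"
proof
  assume "Cref (B, C)"
  then have ref: "(a, a) \<in> C" if "a \<in> carrier B" "a \<noteq> \<zero>" for a using that by auto
  have "(a, b) \<in> C" if "u \<in> Ult B" "a \<in> u" "b \<in> u" for u a b
  proof -
    have ab: "a \<in> carrier B" "b \<in> carrier B" using that Ult_subset by auto
    \<comment> \<open>Reflexivity is applied to the common lower bound, whose contact with itself is
      inherited by the two larger elements.\<close>
    then have "a \<otimes> b \<in> u" using that Ult_meet by auto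
    then have "(a \<otimes> b, a \<otimes> b) \<in> C" using ref ab Ult_zero[OF that(1)] by (metis m_closed)
    then show ?thesis
      using C_mono_left[OF _ meet_le] C_mono_right[OF _ meet_le'] ab by blast
  qed
  then show "refl_on (Ult B) (ult_rel B C)" by (auto simp: refl_on_def ult_rel_def)
next
  assume *: "refl_on (Ult B) (ult_rel B C)"
  have "(a, a) \<in> C" if a: "a \<in> carrier B" "a \<noteq> \<zero>" for a
  proof -
    obtain u where u: "u \<in> Ult B" "a \<in> u" using ultrafilter_exists[OF a] .
    then have "(u, u) \<in> ult_rel B C" using * by (auto simp: refl_on_def)
    then show ?thesis using u by (auto simp: ult_rel_def)
  qed
  then show "Cref (B, C)" by simp
qed

lemma Csym_iff: "Csym (B, C) \<longleftrightarrow> sym (ult_rel B C)"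
proof
  assume *: "sym (ult_rel B C)"
  have "(b, a) \<in> C" if "(a, b) \<in> C" for a b
    by (rule ult_rel_exists[OF that]) (use * in \<open>auto simp: sym_def ult_rel_def\<close>)
  then show "Csym (B, C)" unfolding Csym.simps by blast
next
  assume "Csym (B, C)"
  then have "(b, a) \<in> C" if "(a, b) \<in> C" for a b using that C_carrier[OF that] by simp
  then show "sym (ult_rel B C)" unfolding sym_def ult_rel_def by blast
qed

text \<open>An interpolant \<open>b\<close> or its complement belongs to the middle ultrafilter, and
  each case contradicts one of the two relations. Conversely, a missing interpolant yields a middle
  ultrafilter through which transitivity forces contact.\<close>

lemma Ctr_iff: "Ctr (B, C) \<longleftrightarrow> trans (ult_rel B C)"
proof
  assume "Ctr (B, C)"
  then have tr: "\<exists>b\<in>carrier B. (a, compl B b) \<notin> C \<and> (b, compl B c) \<notin> C"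
    if "a \<in> carrier B" "c \<in> carrier B" "(a, compl B c) \<notin> C" for a c
    using that by auto
  show "trans (ult_rel B C)"
  proof (rule transI)
    fix u v w assume uvw: "(u, v) \<in> ult_rel B C" "(v, w) \<in> ult_rel B C"
    have "(a, c) \<in> C" if "a \<in> u" "c \<in> w" for a c
    proof (rule ccontr)
      assume "(a, c) \<notin> C"
      moreover have ac: "a \<in> carrier B" "c \<in> carrier B" using that uvw ult_rel_Ult Ult_subset by blast+
      ultimately obtain b where b: "b \<in> carrier B" "(a, compl B b) \<notin> C" "(b, c) \<notin> C"
        using tr[of a "compl B c"] compl_closed compl_compl by auto
      then show False
        using Ult_compl[of v b] that uvw unfolding ult_rel_def by blast
    qed
    then show "(u, w) \<in> ult_rel B C" using uvw unfolding ult_rel_def by auto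
  qed
next
  assume tr: "trans (ult_rel B C)"
  \<comment> \<open>Here \<open>d\<close> stands for the complement that occurs in the
    axiom.\<close>
  have "\<exists>b\<in>carrier B. (a, compl B b) \<notin> C \<and> (b, d) \<notin> C"
    if a: "a \<in> carrier B" and d: "d \<in> carrier B" and ad: "(a, d) \<notin> C" for a d
  proof (rule ccontr)
    assume no: "\<not> ?thesis"
    \<comment> \<open>\<open>F\<close> holds the elements that \<open>a\<close> is well inside of,
      \<open>G\<close> those in contact with \<open>d\<close>. The absence of an interpolant says
      precisely that \<open>F \<subseteq> G\<close>, so an ultrafilter fits between the filter and
      the grill.\<close>
    define F where "F = {b \<in> carrier B. (a, compl B b) \<notin> C}"
    define G where "G = {b \<in> carrier B. (b, d) \<in> C}"
    have FC: "F \<subseteq> carrier B" by (auto simp: F_def)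
    have F: "ba_filter B F"
      unfolding ba_filter_def
    proof (intro conjI ballI impI)
      have "\<one> \<in> F" using C_nonzero by (auto simp: F_def compl_one)
      then show "F \<noteq> {}" by auto
      show "c \<in> F" if "b \<in> F" "c \<in> carrier B" "ba_le B b c" for b c
      proof -
        have "ba_le B (compl B c) (compl B b)"
          using that FC by (simp add: subset_iff le_iff_Ult Ult_simps) blast
        then show ?thesis using that C_mono_right compl_closed by (auto simp: F_def)
      qed
      show "b \<otimes> c \<in> F" if "b \<in> F" "c \<in> F" for b c
      proof -
        have bc: "b \<in> carrier B" "c \<in> carrier B" using that FC by auto
        then have "compl B (b \<otimes> c) = compl B b \<oplus> compl B c"
          by (simp add: eq_iff_Ult Ult_simps)
        then show ?thesis using that C_join_right a bc by (auto simp: F_def compl_closed)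
      qed
    qed (rule FC)
    have FG: "F \<subseteq> G" using no by (auto simp: F_def G_def)
    obtain v where v: "v \<in> Ult B" "F \<subseteq> v" "v \<subseteq> G"
    proof (rule prime_filter[OF F FG])
      show "\<zero> \<notin> G" using C_nonzero by (auto simp: G_def)
      show "\<And>a b. \<lbrakk>a \<in> G; a \<in> carrier B; b \<in> carrier B; ba_le B a b\<rbrakk> \<Longrightarrow> b \<in> G"
        using C_mono_left by (auto simp: G_def)
      show "\<And>a b. \<lbrakk>a \<in> carrier B; b \<in> carrier B; a \<oplus> b \<in> G\<rbrakk> \<Longrightarrow> a \<in> G \<or> b \<in> G"
        using C_join_left d by (auto simp: G_def)
    qed (rule that, auto simp: mem_Ult_iff)
    \<comment> \<open>The inclusion \<open>F \<subseteq> v\<close> puts \<open>a\<close> in contact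
      with all of \<open>v\<close>, and \<open>v \<subseteq> G\<close> does the same for
      \<open>d\<close> on the other side. Both ends therefore extend to ultrafilters.\<close>
    have "(a, b) \<in> C" if "b \<in> v" for b
    proof (rule ccontr)
      assume "(a, b) \<notin> C"
      moreover have "b \<in> carrier B" using that v Ult_subset by auto
      ultimately have "compl B b \<in> F" by (simp add: F_def compl_closed compl_compl)
      then show False using that v \<open>b \<in> carrier B\<close> Ult_compl by auto
    qed
    then obtain u where u: "u \<in> Ult B" "a \<in> u" "u \<times> v \<subseteq> C"
      using ult_rel_extend'[OF v(1) a] by blast
    obtain w where w: "w \<in> Ult B" "d \<in> w" "v \<times> w \<subseteq> C"
      using ult_rel_extend[OF v(1) d] v(3) by (auto simp: G_def)
    have "(u, w) \<in> ult_rel B C"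
      using u v w by (intro transD[OF tr, of u v w]) (auto simp: ult_rel_def)
    then show False using ad u w by (auto simp: ult_rel_def)
  qed
  then show "Ctr (B, C)" using compl_closed by auto
qed

section \<open>Clans and the contact relation they induce\<close>

lemma clanD:
  assumes "\<Gamma> \<in> Clans (B, C)"
  shows "\<Gamma> \<subseteq> carrier B" "\<zero> \<notin> \<Gamma>" "\<one> \<in> \<Gamma>"
    "\<lbrakk>a \<in> \<Gamma>; b \<in> carrier B; ba_le B a b\<rbrakk> \<Longrightarrow> b \<in> \<Gamma>"
    "\<lbrakk>a \<in> \<Gamma>; b \<in> \<Gamma>\<rbrakk> \<Longrightarrow> (a, b) \<in> sharp (B, C)"
proof -
  note \<Gamma> = assms[unfolded Clans.simps mem_Collect_eq]
  show "\<Gamma> \<subseteq> carrier B" "\<zero> \<notin> \<Gamma>" using \<Gamma> by blast+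
  show up: "\<lbrakk>a \<in> \<Gamma>; b \<in> carrier B; ba_le B a b\<rbrakk> \<Longrightarrow> b \<in> \<Gamma>" for a b using \<Gamma> by blast
  show "\<lbrakk>a \<in> \<Gamma>; b \<in> \<Gamma>\<rbrakk> \<Longrightarrow> (a, b) \<in> sharp (B, C)" using \<Gamma> by blast
  obtain c where "c \<in> \<Gamma>" using \<Gamma> by blast
  then show "\<one> \<in> \<Gamma>" using up[of c \<one>] \<Gamma> le_one by blast
qed

lemma clan_join:
  assumes \<Gamma>: "\<Gamma> \<in> Clans (B, C)" and a: "a \<in> carrier B" and b: "b \<in> carrier B"
  shows "a \<oplus> b \<in> \<Gamma> \<longleftrightarrow> a \<in> \<Gamma> \<or> b \<in> \<Gamma>"
proof
  show "a \<oplus> b \<in> \<Gamma> \<Longrightarrow> a \<in> \<Gamma> \<or> b \<in> \<Gamma>"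
    using assms unfolding Clans.simps mem_Collect_eq by blast
  show "a \<in> \<Gamma> \<or> b \<in> \<Gamma> \<Longrightarrow> a \<oplus> b \<in> \<Gamma>"
    using clanD(4)[OF \<Gamma> _ a_closed[OF a b]] le_join[OF a b] le_join'[OF a b] by blast
qed

lemma sharp_meet: "\<lbrakk>a \<in> carrier B; b \<in> carrier B; a \<otimes> b \<noteq> \<zero>\<rbrakk> \<Longrightarrow> (a, b) \<in> sharp (B, C)"
  by simp

lemma Ult_sharp: "\<lbrakk>u \<in> Ult B; a \<in> u; b \<in> u\<rbrakk> \<Longrightarrow> (a, b) \<in> sharp (B, C)"
  using Ult_subset[of u] Ult_meet[of u a b] Ult_zero[of u]
  by (intro sharp_meet) (blast, blast, metis subsetD)

text \<open>Two elements of one ultrafilter have a non-zero meet, and elements taken one from each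
  are in \<open>C\<close> in one of the two orders, so \<open>sharp\<close> covers all pairs. The
  case \<open>u = v\<close> makes each ultrafilter a clan.\<close>

lemma ult_rel_clan:
  assumes uv: "(u, v) \<in> ult_rel B C \<or> u = v" and u: "u \<in> Ult B" and v: "v \<in> Ult B"
  shows "u \<union> v \<in> Clans (B, C)"
  unfolding Clans.simps mem_Collect_eq
proof (intro conjI ballI impI)
  show "u \<union> v \<subseteq> carrier B" "u \<union> v \<noteq> {}" "\<zero> \<notin> u \<union> v"
    using u v Ult_subset Ult_one Ult_zero by blast+
  show "b \<in> u \<union> v" if "a \<in> u \<union> v" "b \<in> carrier B" "ba_le B a b" for a b
    using that u v Ult_le by blast
  show "a \<in> u \<union> v \<or> b \<in> u \<union> v" if "a \<in> carrier B" "b \<in> carrier B" "a \<oplus> b \<in> u \<union> v" for a b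
    using that u v Ult_join by blast
  have uvC: "(a, b) \<in> sharp (B, C) \<and> (b, a) \<in> sharp (B, C)" if "a \<in> u" "b \<in> v" for a b
    using uv
  proof
    assume "(u, v) \<in> ult_rel B C"
    then have "(a, b) \<in> C" using that by (auto simp: ult_rel_def)
    then show ?thesis by (auto dest: C_carrier)
  qed (use Ult_sharp u that in blast)
  show "(a, b) \<in> sharp (B, C)" if "a \<in> u \<union> v" "b \<in> u \<union> v" for a b
    using that uvC Ult_sharp[OF u] Ult_sharp[OF v] by (simp only: Un_iff) blast
qed

lemma Ult_clan: "u \<in> Ult B \<Longrightarrow> u \<in> Clans (B, C)"
  using ult_rel_clan[of u u] by simp

text \<open>Each disjunct in the definition of \<open>sharp\<close> supplies its own clan: a related
  pair of ultrafilters for either order of \<open>C\<close>, a single ultrafilter for a non-zero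
  meet.\<close>

lemma sharp_iff_clan:
  assumes "a \<in> carrier B" "b \<in> carrier B"
  shows "(a, b) \<in> sharp (B, C) \<longleftrightarrow> (\<exists>\<Gamma>\<in>Clans (B, C). a \<in> \<Gamma> \<and> b \<in> \<Gamma>)"
proof
  assume "(a, b) \<in> sharp (B, C)"
  then consider "(a, b) \<in> C" | "(b, a) \<in> C" | "a \<otimes> b \<noteq> \<zero>" by auto
  then show "\<exists>\<Gamma>\<in>Clans (B, C). a \<in> \<Gamma> \<and> b \<in> \<Gamma>"
  proof cases
    case 1
    then obtain u v where uv: "(u, v) \<in> ult_rel B C" "a \<in> u" "b \<in> v" by (rule ult_rel_exists)
    then have "u \<union> v \<in> Clans (B, C)" using ult_rel_clan[of u v] ult_rel_Ult[of u v] by blast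
    then show ?thesis by (rule bexI[rotated]) (use uv in simp)
  next
    case 2
    then obtain u v where uv: "(u, v) \<in> ult_rel B C" "b \<in> u" "a \<in> v" by (rule ult_rel_exists)
    then have "u \<union> v \<in> Clans (B, C)" using ult_rel_clan[of u v] ult_rel_Ult[of u v] by blast
    then show ?thesis by (rule bexI[rotated]) (use uv in simp)
  next
    case 3
    then obtain u where "u \<in> Ult B" "a \<otimes> b \<in> u" using ultrafilter_exists assms by blast
    then show ?thesis using Ult_clan[of u] Ult_meet[OF _ assms, of u] by blast
  qed
qed (blast intro: clanD(5))

text \<open>Via \<open>sharp_iff_clan\<close> the axioms become statements about one clan at a time,
  in which a join is a disjunction.\<close>

lemma precontact_sharp: "precontact B (sharp (B, C))"
proof unfold_locales
  show "sharp (B, C) \<subseteq> carrier B \<times> carrier B" by auto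
  show "a \<noteq> \<zero> \<and> b \<noteq> \<zero>" if ab: "(a, b) \<in> sharp (B, C)" for a b
  proof -
    have "a \<in> carrier B" "b \<in> carrier B" using ab by auto
    then show ?thesis using ab clanD(2) by (auto simp only: sharp_iff_clan)
  qed
qed (simp_all only: sharp_iff_clan a_closed clan_join bex_disj_distrib[symmetric] cong: bex_cong, blast+)

lemma contact_algebra_sharp: "contact_algebra (B, sharp (B, C))"
proof -
  have "(a, a) \<in> sharp (B, C)" if "a \<in> carrier B" "a \<noteq> \<zero>" for a
    using that meet_idem sharp_meet by auto
  then have "Cref (B, sharp (B, C))" by simp
  moreover have "Csym (B, sharp (B, C))" by (auto simp: m_comm)
  ultimately show ?thesis
    using precontact_sharp unfolding contact_algebra_def precontact_algebra_iff by blast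
qed

end

section \<open>Isomorphisms\<close>

lemma ba_iso_iff:
  "h \<in> ba_iso A B \<longleftrightarrow> bij_betw h (carrier A) (carrier B) \<and>
    h \<zero>\<^bsub>A\<^esub> = \<zero>\<^bsub>B\<^esub> \<and> h \<one>\<^bsub>A\<^esub> = \<one>\<^bsub>B\<^esub> \<and>
    (\<forall>a\<in>carrier A. h (compl A a) = compl B (h a)) \<and>
    (\<forall>a\<in>carrier A. \<forall>b\<in>carrier A. h (a \<otimes>\<^bsub>A\<^esub> b) = h a \<otimes>\<^bsub>B\<^esub> h b \<and> h (a \<oplus>\<^bsub>A\<^esub> b) = h a \<oplus>\<^bsub>B\<^esub> h b)"
  unfolding ba_iso_def ring_iso_def ring_hom_def by (auto dest: bij_betwE)

text \<open>\<open>B\<close> is a bare record here. Its Boolean laws are a conclusion,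
  \<open>boolean_alg_image\<close>, which is how \<open>RC_pair X X0\<close> becomes a Boolean
  algebra.\<close>

locale boolean_iso = boolean_alg A for A :: "'a boolalg" and B :: "'b boolalg" and h +
  assumes iso: "h \<in> ba_iso A B"
begin

lemma bij: "bij_betw h (carrier A) (carrier B)"
  using iso by (simp add: ba_iso_iff)

lemma inj: "inj_on h (carrier A)" and surj: "h ` carrier A = carrier B"
  using bij by (auto simp: bij_betw_def)

lemma hom:
  "h \<zero>\<^bsub>A\<^esub> = \<zero>\<^bsub>B\<^esub>" "h \<one>\<^bsub>A\<^esub> = \<one>\<^bsub>B\<^esub>"
  "a \<in> carrier A \<Longrightarrow> h (compl A a) = compl B (h a)"
  "a \<in> carrier A \<Longrightarrow> b \<in> carrier A \<Longrightarrow> h (a \<otimes>\<^bsub>A\<^esub> b) = h a \<otimes>\<^bsub>B\<^esub> h b"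
  "a \<in> carrier A \<Longrightarrow> b \<in> carrier A \<Longrightarrow> h (a \<oplus>\<^bsub>A\<^esub> b) = h a \<oplus>\<^bsub>B\<^esub> h b"
  using iso by (simp_all add: ba_iso_iff)

lemma closed: "a \<in> carrier A \<Longrightarrow> h a \<in> carrier B"
  using surj by auto

lemma eq_iff: "a \<in> carrier A \<Longrightarrow> b \<in> carrier A \<Longrightarrow> h a = h b \<longleftrightarrow> a = b"
  using inj by (simp add: inj_on_eq_iff)

lemma le_iff: "a \<in> carrier A \<Longrightarrow> b \<in> carrier A \<Longrightarrow> ba_le B (h a) (h b) \<longleftrightarrow> ba_le A a b"
  unfolding ba_le_def by (simp add: hom(4)[symmetric] eq_iff)

lemma mem_image_iff: "a \<in> carrier A \<Longrightarrow> u \<subseteq> carrier A \<Longrightarrow> h a \<in> h ` u \<longleftrightarrow> a \<in> u"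
  using inj by (rule inj_on_image_mem_iff)

lemma ball_carrier: "(\<forall>x\<in>carrier B. P x) \<longleftrightarrow> (\<forall>a\<in>carrier A. P (h a))"
  by (simp flip: surj)

lemma boolean_alg_image: "boolean_alg B"
proof -
  note h = hom(3-5)[symmetric] hom(1,2)[symmetric]
  have pre: "\<exists>a\<in>carrier A. x = h a" if "x \<in> carrier B" for x
    using that surj by auto
  show ?thesis
  proof (intro boolean_alg.intro comm_monoidI abelian_monoidI boolean_alg_axioms.intro)
    fix x assume x: "x \<in> carrier B"
    then obtain a where a: "a \<in> carrier A" "x = h a" using pre by blast
    show "\<one>\<^bsub>B\<^esub> \<otimes>\<^bsub>B\<^esub> x = x" "\<zero>\<^bsub>B\<^esub> \<oplus>\<^bsub>B\<^esub> x = x" "compl B x \<in> carrier B"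
      "x \<otimes>\<^bsub>B\<^esub> compl B x = \<zero>\<^bsub>B\<^esub>" "x \<oplus>\<^bsub>B\<^esub> compl B x = \<one>\<^bsub>B\<^esub>"
      using a by (simp_all add: h closed compl_closed mult_compl add_compl)
    fix y assume y: "y \<in> carrier B"
    then obtain b where b: "b \<in> carrier A" "y = h b" using pre by blast
    show "x \<otimes>\<^bsub>B\<^esub> y \<in> carrier B" "x \<oplus>\<^bsub>B\<^esub> y \<in> carrier B"
      using a b by (simp_all add: h closed)
    show "x \<otimes>\<^bsub>B\<^esub> y = y \<otimes>\<^bsub>B\<^esub> x" "x \<oplus>\<^bsub>B\<^esub> y = y \<oplus>\<^bsub>B\<^esub> x"
      using a b m_comm[of a b] a_comm[of a b] by (simp_all add: h)
    fix z assume z: "z \<in> carrier B"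
    then obtain c where c: "c \<in> carrier A" "z = h c" using pre by blast
    show "x \<otimes>\<^bsub>B\<^esub> y \<otimes>\<^bsub>B\<^esub> z = x \<otimes>\<^bsub>B\<^esub> (y \<otimes>\<^bsub>B\<^esub> z)"
      "x \<oplus>\<^bsub>B\<^esub> y \<oplus>\<^bsub>B\<^esub> z = x \<oplus>\<^bsub>B\<^esub> (y \<oplus>\<^bsub>B\<^esub> z)"
      using a b c m_assoc[of a b c] a_assoc[of a b c] by (simp_all add: h)
    show "x \<otimes>\<^bsub>B\<^esub> (y \<oplus>\<^bsub>B\<^esub> z) = x \<otimes>\<^bsub>B\<^esub> y \<oplus>\<^bsub>B\<^esub> x \<otimes>\<^bsub>B\<^esub> z"
      "x \<oplus>\<^bsub>B\<^esub> y \<otimes>\<^bsub>B\<^esub> z = (x \<oplus>\<^bsub>B\<^esub> y) \<otimes>\<^bsub>B\<^esub> (x \<oplus>\<^bsub>B\<^esub> z)"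
      using a b c mult_add_distrib[of a b c] add_mult_distrib[of a b c] by (simp_all add: h)
  next
    show "\<one>\<^bsub>B\<^esub> \<in> carrier B" "\<zero>\<^bsub>B\<^esub> \<in> carrier B"
      by (simp_all add: h closed)
  qed
qed

lemma inverse_iso: "inv_into (carrier A) h \<in> ba_iso B A"
proof -
  have inv: "inv_into (carrier A) h (h a) = a" if "a \<in> carrier A" for a
    using inj that by simp
  show ?thesis
    unfolding ba_iso_iff ball_carrier
    using bij_betw_inv_into[OF bij] by (simp add: hom[symmetric] inv compl_closed)
qed

lemma Ult_image: "u \<in> Ult A \<Longrightarrow> h ` u \<in> Ult B"
proof -
  assume u: "u \<in> Ult A"
  interpret B: boolean_alg B by (rule boolean_alg_image)
  note us = Ult_subset[OF u]
  have "\<forall>x\<in>h ` u. \<forall>y\<in>h ` u. x \<otimes>\<^bsub>B\<^esub> y \<in> h ` u"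
    using us by (simp add: subset_iff hom(4)[symmetric] mem_image_iff Ult_meet[OF u])
  moreover have "\<forall>x\<in>h ` u. \<forall>y\<in>carrier B. ba_le B x y \<longrightarrow> y \<in> h ` u"
    unfolding ball_carrier
  proof (intro ballI impI)
    fix x b assume "x \<in> h ` u" "b \<in> carrier A" "ba_le B x (h b)"
    then obtain a where "a \<in> u" "a \<in> carrier A" "ba_le A a b" using us le_iff by auto
    then show "h b \<in> h ` u" using Ult_le[OF u _ \<open>b \<in> carrier A\<close>] by blast
  qed
  moreover have "\<zero>\<^bsub>B\<^esub> \<notin> h ` u"
    using Ult_zero[OF u] us by (simp add: hom(1)[symmetric] mem_image_iff)
  moreover have "\<forall>a\<in>carrier B. a \<in> h ` u \<or> compl B a \<in> h ` u"
    unfolding ball_carrier using us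
    by (simp add: hom(3)[symmetric] mem_image_iff compl_closed Ult_compl[OF u])
  moreover have "h ` u \<noteq> {}" "h ` u \<subseteq> carrier B" using Ult_one[OF u] us closed by auto
  ultimately show ?thesis unfolding B.mem_Ult_iff ba_filter_def by (intro conjI)
qed

end

lemma ba_iso_comp: "f \<in> ba_iso A B \<Longrightarrow> g \<in> ba_iso B D \<Longrightarrow> g \<circ> f \<in> ba_iso A D"
  unfolding ba_iso_iff by (auto intro: bij_betw_trans dest: bij_betwE)

text \<open>Isomorphisms compare pairs inside the carriers alone, so containment of
  \<open>C'\<close> has to be assumed before the axioms can be transported.\<close>

locale precontact_iso = precontact A C for A :: "'a boolalg" and C +
  fixes B :: "'b boolalg" and C' h
  assumes pca_iso: "h \<in> pca_iso (A, C) (B, C')" and C': "C' \<subseteq> carrier B \<times> carrier B"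

sublocale precontact_iso \<subseteq> boolean_iso A B h
  using pca_iso by unfold_locales simp

context precontact_iso
begin

lemma rel_iff: "a \<in> carrier A \<Longrightarrow> b \<in> carrier A \<Longrightarrow> (h a, h b) \<in> C' \<longleftrightarrow> (a, b) \<in> C"
  using pca_iso by simp

lemma precontact_image: "precontact B C'"
proof (rule precontact.intro[OF boolean_alg_image], unfold_locales)
  have pre: "\<exists>a\<in>carrier A. x = h a" if "x \<in> carrier B" for x
    using that surj by auto
  show "C' \<subseteq> carrier B \<times> carrier B" by (rule C')
  show "x \<noteq> \<zero>\<^bsub>B\<^esub> \<and> y \<noteq> \<zero>\<^bsub>B\<^esub>" if xy: "(x, y) \<in> C'" for x y
  proof -
    obtain a b where ab: "a \<in> carrier A" "x = h a" "b \<in> carrier A" "y = h b"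
      using xy C' pre[of x] pre[of y] by auto
    then have "(a, b) \<in> C" using rel_iff xy by simp
    then show ?thesis using C_nonzero[of a b] ab by (simp add: hom(1)[symmetric] eq_iff)
  qed
  fix x y z assume "x \<in> carrier B" "y \<in> carrier B" "z \<in> carrier B"
  then obtain a b c where abc: "a \<in> carrier A" "x = h a" "b \<in> carrier A" "y = h b" "c \<in> carrier A" "z = h c"
    using pre[of x] pre[of y] pre[of z] by auto
  show "(x, y \<oplus>\<^bsub>B\<^esub> z) \<in> C' \<longleftrightarrow> (x, y) \<in> C' \<or> (x, z) \<in> C'"
    "(x \<oplus>\<^bsub>B\<^esub> y, z) \<in> C' \<longleftrightarrow> (x, z) \<in> C' \<or> (y, z) \<in> C'"
    using abc by (simp_all add: hom(5)[symmetric] rel_iff C_join_right C_join_left)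
qed

lemma sharp_rel_iff:
  "a \<in> carrier A \<Longrightarrow> b \<in> carrier A \<Longrightarrow> (h a, h b) \<in> sharp (B, C') \<longleftrightarrow> (a, b) \<in> sharp (A, C)"
  by (simp add: rel_iff closed hom(1,4)[symmetric] eq_iff)

lemma inverse_pca_iso: "inv_into (carrier A) h \<in> pca_iso (B, C') (A, C)"
proof -
  have "inv_into (carrier A) h (h a) = a" if "a \<in> carrier A" for a
    using inj that by simp
  then show ?thesis
    using inverse_iso by (simp add: ball_carrier rel_iff)
qed

lemma clan_image:
  assumes \<Gamma>: "\<Gamma> \<in> Clans (A, C)" shows "h ` \<Gamma> \<in> Clans (B, C')"
  unfolding Clans.simps mem_Collect_eq ball_carrier
proof (intro conjI ballI impI)
  note \<Gamma>s = clanD(1)[OF \<Gamma>]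
  show "h ` \<Gamma> \<subseteq> carrier B" using \<Gamma>s closed by auto
  show "h ` \<Gamma> \<noteq> {}" using clanD(3)[OF \<Gamma>] by auto
  show "\<zero>\<^bsub>B\<^esub> \<notin> h ` \<Gamma>"
    using clanD(2)[OF \<Gamma>] \<Gamma>s by (simp add: hom(1)[symmetric] mem_image_iff)
  show "h b \<in> h ` \<Gamma>" if "x \<in> h ` \<Gamma>" "b \<in> carrier A" "ba_le B x (h b)" for x b
  proof -
    from that(1) obtain a where "a \<in> \<Gamma>" "x = h a" by blast
    then have "a \<in> \<Gamma>" "ba_le A a b" using that(2,3) \<Gamma>s le_iff by auto
    then show ?thesis using clanD(4)[OF \<Gamma> _ \<open>b \<in> carrier A\<close>] by blast
  qed
  show "h a \<in> h ` \<Gamma> \<or> h b \<in> h ` \<Gamma>"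
    if "a \<in> carrier A" "b \<in> carrier A" "h a \<oplus>\<^bsub>B\<^esub> h b \<in> h ` \<Gamma>" for a b
    using that \<Gamma>s clan_join[OF \<Gamma>, of a b] by (simp add: hom(5)[symmetric] mem_image_iff)
  show "(x, y) \<in> sharp (B, C')" if "x \<in> h ` \<Gamma>" "y \<in> h ` \<Gamma>" for x y
  proof -
    obtain a b where ab: "a \<in> \<Gamma>" "x = h a" "b \<in> \<Gamma>" "y = h b" using \<open>x \<in> h ` \<Gamma>\<close> \<open>y \<in> h ` \<Gamma>\<close> by blast
    then have "a \<in> carrier A" "b \<in> carrier A" using \<Gamma>s by auto
    then show ?thesis using ab clanD(5)[OF \<Gamma>, of a b] sharp_rel_iff[of a b] by simp
  qed
qed

lemma inverse_precontact_iso: "precontact_iso B C' A C (inv_into (carrier A) h)"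
  by (intro precontact_iso.intro precontact_iso_axioms.intro precontact_image inverse_pca_iso C_subset)

lemma image_inverse: "v \<subseteq> carrier B \<Longrightarrow> h ` inv_into (carrier A) h ` v = v"
  using surj by (simp add: image_inv_into_cancel)

text \<open>Surjectivity comes from applying \<open>Ult_image\<close> to the inverse
  isomorphism.\<close>

lemma Ult_bij: "image h ` Ult A = Ult B"
proof
  interpret inv: precontact_iso B C' A C "inv_into (carrier A) h" by (rule inverse_precontact_iso)
  show "Ult B \<subseteq> image h ` Ult A"
  proof
    fix v assume v: "v \<in> Ult B"
    have "v = h ` inv_into (carrier A) h ` v" using image_inverse[OF inv.Ult_subset[OF v]] by simp
    then show "v \<in> image h ` Ult A" using inv.Ult_image[OF v] by blast
  qed
qed (use Ult_image in blast)

lemma Clans_image: "image h ` Clans (A, C) = Clans (B, C')"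
proof
  interpret inv: precontact_iso B C' A C "inv_into (carrier A) h" by (rule inverse_precontact_iso)
  show "Clans (B, C') \<subseteq> image h ` Clans (A, C)"
  proof
    fix v assume v: "v \<in> Clans (B, C')"
    have "v = h ` inv_into (carrier A) h ` v" using image_inverse[OF inv.clanD(1)[OF v]] by simp
    then show "v \<in> image h ` Clans (A, C)" using inv.clan_image[OF v] by blast
  qed
qed (use clan_image in blast)

lemma Clans_bij: "bij_betw (image h) (Clans (A, C)) (Clans (B, C'))"
proof -
  have "inj_on (image h) (Clans (A, C))"
    using inj_on_image_Pow[OF inj] by (rule inj_on_subset) (use clanD(1) in blast)
  then show ?thesis using Clans_image by (simp add: bij_betw_def)
qed

lemma gmap_image:
  assumes a: "a \<in> carrier A" shows "gmap (B, C') (h a) = image h ` gmap (A, C) a"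
proof -
  have "h a \<in> h ` \<Gamma> \<longleftrightarrow> a \<in> \<Gamma>" if "\<Gamma> \<in> Clans (A, C)" for \<Gamma>
    using mem_image_iff[OF a clanD(1)[OF that]] .
  then show ?thesis unfolding gmap_def Clans_image[symmetric] by blast
qed

lemma ult_rel_image:
  assumes u: "u \<in> Ult A" and v: "v \<in> Ult A"
  shows "(h ` u, h ` v) \<in> ult_rel B C' \<longleftrightarrow> (u, v) \<in> ult_rel A C"
proof -
  have "(h a, h b) \<in> C' \<longleftrightarrow> (a, b) \<in> C" if "a \<in> u" "b \<in> v" for a b
    using that u v Ult_subset rel_iff by blast
  then have "h ` u \<times> h ` v \<subseteq> C' \<longleftrightarrow> u \<times> v \<subseteq> C" by blast
  then show ?thesis using Ult_image u v by (simp add: ult_rel_def)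
qed

end

lemma pca_iso_comp:
  "f \<in> pca_iso (A, C) (B, C') \<Longrightarrow> g \<in> pca_iso (B, C') (D, C'') \<Longrightarrow> g \<circ> f \<in> pca_iso (A, C) (D, C'')"
  using ba_iso_comp[of f A B g D] by (auto simp: ba_iso_iff dest: bij_betwE)

lemma precontact_isoI:
  assumes "precontact_algebra (A, C)" "h \<in> pca_iso (A, C) (B, C')" "C' \<subseteq> carrier B \<times> carrier B"
  shows "precontact_iso A C B C' h"
  using assms unfolding precontact_iso_def precontact_iso_axioms_def precontact_algebra_iff by blast

lemma pca_isomorphic_trans:
  "pca_isomorphic A B \<Longrightarrow> pca_isomorphic B D \<Longrightarrow> pca_isomorphic A D"
  by (cases A, cases B, cases D) (auto simp only: pca_isomorphic_def ex_in_conv[symmetric] dest: pca_iso_comp)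

lemma pca_isomorphic_sym:
  assumes "precontact_algebra A" "precontact_algebra B" "pca_isomorphic A B"
  shows "pca_isomorphic B A"
proof -
  obtain A1 C B1 C' where AB: "A = (A1, C)" "B = (B1, C')" by fastforce
  then obtain h where h: "h \<in> pca_iso (A1, C) (B1, C')" using assms(3) by (auto simp: pca_isomorphic_def)
  interpret precontact_iso A1 C B1 C' h
    by (rule precontact_isoI) (use assms h AB precontact.C_subset in \<open>auto simp only: precontact_algebra_iff\<close>)
  show ?thesis using inverse_pca_iso AB unfolding pca_isomorphic_def by blast
qed

section \<open>Topological pairs\<close>

text \<open>The closure is itself an intersection of basic sets, each containing \<open>S\<close>;
  the other inclusion holds because basic sets are closed.\<close>

lemma closed_base_closure:
  assumes \<B>: "closed_base X \<B>" and S: "S \<subseteq> topspace X"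
  shows "X closure_of S = {x \<in> topspace X. \<forall>F\<in>\<B>. S \<subseteq> F \<longrightarrow> x \<in> F}"
proof (intro equalityI subsetI)
  fix x assume "x \<in> X closure_of S"
  moreover have "closedin X F" if "F \<in> \<B>" for F using \<B> that by (auto simp: closed_base_def)
  ultimately show "x \<in> {x \<in> topspace X. \<forall>F\<in>\<B>. S \<subseteq> F \<longrightarrow> x \<in> F}"
    using closure_of_minimal[of S _ X] closure_of_subset_topspace[of X S] by blast
next
  fix x assume x: "x \<in> {x \<in> topspace X. \<forall>F\<in>\<B>. S \<subseteq> F \<longrightarrow> x \<in> F}"
  obtain \<G> where \<G>: "\<G> \<subseteq> \<B>" "X closure_of S = topspace X \<inter> \<Inter>\<G>"
    using \<B> closedin_closure_of[of X S] unfolding closed_base_def by blast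
  have "S \<subseteq> topspace X \<inter> \<Inter>\<G>" using closure_of_subset[OF S] \<G>(2) by simp
  then have "S \<subseteq> F" if "F \<in> \<G>" for F using that by blast
  then have "x \<in> F" if "F \<in> \<G>" for F using x \<G>(1) that by blast
  then show "x \<in> X closure_of S" using x \<G>(2) by auto
qed

text \<open>A bijection commutes with intersections, so matching the bases matches all closed sets
  in both directions. The map induced by an algebra isomorphism and the map from a space to its
  clans are both handled this way.\<close>

lemma closed_base_homeomorphic_map:
  assumes bij: "bij_betw f (topspace X) (topspace Y)"
    and \<A>: "closed_base X \<A>" and \<B>: "closed_base Y \<B>" and eq: "\<B> = image f ` \<A>"
  shows "homeomorphic_map X Y f"
proof (rule bijective_closed_imp_homeomorphic_map)
  have inj: "inj_on f (topspace X)" and surj: "f ` topspace X = topspace Y"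
    using bij by (auto simp: bij_betw_def)
  then show "f ` topspace X = topspace Y" "inj_on f (topspace X)" by auto
  have sub: "F \<subseteq> topspace X" if "F \<in> \<A>" for F
    using \<A> that closedin_subset by (auto simp: closed_base_def)
  have mem: "f x \<in> f ` F \<longleftrightarrow> x \<in> F" if "F \<in> \<A>" "x \<in> topspace X" for F x
    using inj_on_image_mem_iff[OF inj that(2) sub[OF that(1)]] .
  have closed: "closedin Y (f ` F)" if "F \<in> \<A>" for F
    using \<B> that by (auto simp: closed_base_def eq)
  show "closed_map X Y f"
    unfolding closed_map_def
  proof (intro allI impI)
    fix S assume "closedin X S"
    then obtain \<G> where \<G>: "\<G> \<subseteq> \<A>" "S = topspace X \<inter> \<Inter>\<G>"
      using \<A> unfolding closed_base_def by blast
    have "f ` S = topspace Y \<inter> \<Inter>(image f ` \<G>)"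
      using \<G> mem unfolding surj[symmetric] by blast
    \<comment> \<open>Inserting the whole space keeps the family non-empty, as
      \<open>closedin_Inter\<close> requires.\<close>
    moreover have "closedin Y (\<Inter>(insert (topspace Y) (image f ` \<G>)))"
      by (rule closedin_Inter) (use \<G>(1) closed in auto)
    ultimately show "closedin Y (f ` S)" by simp
  qed
  show "continuous_map X Y f"
    unfolding continuous_map_closedin
  proof (intro conjI allI impI)
    show "f \<in> topspace X \<rightarrow> topspace Y" using surj by auto
    fix T assume "closedin Y T"
    then obtain \<H> where \<H>: "\<H> \<subseteq> \<B>" "T = topspace Y \<inter> \<Inter>\<H>"
      using \<B> unfolding closed_base_def by blast
    have "f x \<in> \<Inter>\<H> \<longleftrightarrow> x \<in> \<Inter>{F \<in> \<A>. f ` F \<in> \<H>}" if "x \<in> topspace X" for x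
    proof -
      have "f x \<in> \<Inter>\<H> \<longleftrightarrow> (\<forall>F\<in>\<A>. f ` F \<in> \<H> \<longrightarrow> f x \<in> f ` F)"
        using \<H>(1) unfolding eq by blast
      then show ?thesis using mem[OF _ that] by auto
    qed
    then have "{x \<in> topspace X. f x \<in> T} = \<Inter>(insert (topspace X) {F \<in> \<A>. f ` F \<in> \<H>})"
      using \<H>(2) surj by auto
    moreover have "closedin X (\<Inter>(insert (topspace X) {F \<in> \<A>. f ` F \<in> \<H>}))"
      by (rule closedin_Inter) (use \<A> in \<open>auto simp: closed_base_def\<close>)
    ultimately show "closedin X {x \<in> topspace X. f x \<in> T}" by simp
  qed
qed

section \<open>Clopen sets of the dense subspace and their closures\<close>

lemma clopen_alg_simps:
  "carrier (clopen_alg T) = {U. openin T U \<and> closedin T U}" "\<zero>\<^bsub>clopen_alg T\<^esub> = {}"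
  "\<one>\<^bsub>clopen_alg T\<^esub> = topspace T" "F \<otimes>\<^bsub>clopen_alg T\<^esub> G = F \<inter> G" "F \<oplus>\<^bsub>clopen_alg T\<^esub> G = F \<union> G"
  "compl (clopen_alg T) F = topspace T - F"
  by (simp_all add: clopen_alg_def)

lemma RC_pair_simps:
  "carrier (RC_pair X X0) = (closure_of) X ` carrier (CO_sub X X0)" "\<zero>\<^bsub>RC_pair X X0\<^esub> = {}"
  "\<one>\<^bsub>RC_pair X X0\<^esub> = topspace X"
  "F \<otimes>\<^bsub>RC_pair X X0\<^esub> G = X closure_of (X interior_of (F \<inter> G))" "F \<oplus>\<^bsub>RC_pair X X0\<^esub> G = F \<union> G"
  "compl (RC_pair X X0) F = X closure_of (topspace X - F)"
  by (auto simp: RC_pair_def RC_def)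

lemma boolean_alg_clopen: "boolean_alg (clopen_alg T)"
  by (intro boolean_alg.intro comm_monoidI abelian_monoidI boolean_alg_axioms.intro)
    (auto simp: clopen_alg_simps intro: openin_Un openin_Int openin_diff closedin_diff dest: openin_subset)

lemma precontact_rel_contact: "precontact (CO_sub X X0) (rel_contact X X0 R)"
  unfolding CO_sub_def
  by (intro precontact.intro boolean_alg_clopen precontact_axioms.intro)
    (auto simp: rel_contact_def CO_sub_def clopen_alg_simps)

locale top_pair =
  fixes X :: "'x topology" and X0
  assumes pair: "topological_pair X X0"
begin

lemma subspace: "X0 \<subseteq> topspace X" and dense: "X closure_of X0 = topspace X"
  using pair by (auto simp: topological_pair_def)

lemma topspace_X0: "topspace (subtopology X X0) = X0"
  using subspace by auto

lemmas CO_simps = clopen_alg_simps[of "subtopology X X0", folded CO_sub_def, unfolded topspace_X0]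

lemma CO_subset: "F \<in> carrier (CO_sub X X0) \<Longrightarrow> F \<subseteq> X0"
  using closedin_subset topspace_X0 by (fastforce simp: CO_simps)

text \<open>The closure in a subspace is the trace of the closure. A relatively closed set is thus
  recovered from its closure, which gives injectivity of the closure map on clopen sets.\<close>

lemma closure_Int_X0:
  assumes F: "closedin (subtopology X X0) F" shows "X closure_of F \<inter> X0 = F"
proof -
  have "X0 \<inter> F = F" using closedin_subset[OF F] topspace_X0 by auto
  then show ?thesis
    using closure_of_subtopology[of X X0 F] closure_of_closedin[OF F] by (simp add: Int_commute)
qed

lemma closure_Int_dense: "openin X U \<Longrightarrow> X closure_of (U \<inter> X0) = X closure_of U"
  using closure_of_openin_Int_closure_of[of X U X0] dense openin_subset[of X U]
  by (simp add: Int_absorb2)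

text \<open>Write \<open>F\<close> as the trace of an open \<open>U\<close>. By density
  \<open>F\<close> and \<open>U\<close> have the same closure, so \<open>U\<close> lies in the
  interior of that closure.\<close>

lemma interior_closure_Int_X0:
  assumes F: "F \<in> carrier (CO_sub X X0)"
  shows "X interior_of (X closure_of F) \<inter> X0 = F"
proof
  show "X interior_of (X closure_of F) \<inter> X0 \<subseteq> F"
    using interior_of_subset[of X "X closure_of F"] closure_Int_X0[of F] F by (auto simp: CO_simps)
  obtain U where U: "openin X U" "F = U \<inter> X0"
    using F by (auto simp: CO_simps openin_subtopology)
  have "U \<subseteq> X closure_of F"
    using closure_Int_dense[OF U(1)] closure_of_subset[OF openin_subset[OF U(1)]] U(2) by simp
  then show "F \<subseteq> X interior_of (X closure_of F) \<inter> X0"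
    using interior_of_maximal[of U "X closure_of F" X] U by blast
qed

text \<open>An open set and its trace on \<open>X0\<close> have the same closure. For complement and
  meet it therefore suffices to find an open set with the right trace: the complement of
  \<open>X closure_of F\<close>, and the interior of the intersection of the two closures.\<close>

lemma closure_iso: "(closure_of) X \<in> ba_iso (CO_sub X X0) (RC_pair X X0)"
  unfolding ba_iso_iff
proof (intro conjI ballI)
  have "inj_on ((closure_of) X) (carrier (CO_sub X X0))"
    by (rule inj_onI) (metis (no_types, lifting) CO_simps(1) closure_Int_X0 mem_Collect_eq)
  then show "bij_betw ((closure_of) X) (carrier (CO_sub X X0)) (carrier (RC_pair X X0))"
    by (simp add: bij_betw_def RC_pair_simps)
  show "X closure_of \<zero>\<^bsub>CO_sub X X0\<^esub> = \<zero>\<^bsub>RC_pair X X0\<^esub>" "X closure_of \<one>\<^bsub>CO_sub X X0\<^esub> = \<one>\<^bsub>RC_pair X X0\<^esub>"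
    by (simp_all add: CO_simps RC_pair_simps dense)
next
  fix F assume F: "F \<in> carrier (CO_sub X X0)"
  have "X closure_of (topspace X - X closure_of F) = X closure_of ((topspace X - X closure_of F) \<inter> X0)"
    by (simp add: closure_Int_dense openin_diff)
  also have "(topspace X - X closure_of F) \<inter> X0 = X0 - F"
    using closure_Int_X0[of F] F subspace by (auto simp: CO_simps)
  finally show "X closure_of compl (CO_sub X X0) F = compl (RC_pair X X0) (X closure_of F)"
    by (simp add: CO_simps RC_pair_simps)
  fix G assume G: "G \<in> carrier (CO_sub X X0)"
  have "X interior_of (X closure_of F \<inter> X closure_of G) \<inter> X0 = F \<inter> G"
    using interior_closure_Int_X0[OF F] interior_closure_Int_X0[OF G]
    by (auto simp: interior_of_Int)
  then show "X closure_of (F \<otimes>\<^bsub>CO_sub X X0\<^esub> G) = (X closure_of F) \<otimes>\<^bsub>RC_pair X X0\<^esub> (X closure_of G)"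
    using closure_Int_dense[of "X interior_of (X closure_of F \<inter> X closure_of G)"]
    by (simp add: CO_simps RC_pair_simps)
  show "X closure_of (F \<oplus>\<^bsub>CO_sub X X0\<^esub> G) = (X closure_of F) \<oplus>\<^bsub>RC_pair X X0\<^esub> (X closure_of G)"
    by (simp add: CO_simps RC_pair_simps closure_of_Un)
qed

lemma closure_pca_iso:
  "(closure_of) X \<in> pca_iso (CO_sub X X0, rel_contact X X0 R) (canonical_algebra (X, X0, R))"
proof -
  have "(F, G) \<in> rel_contact X X0 R \<longleftrightarrow> (X closure_of F, X closure_of G) \<in> snd (canonical_algebra (X, X0, R))"
    if "F \<in> carrier (CO_sub X X0)" "G \<in> carrier (CO_sub X X0)" for F G
    using that closure_Int_X0[of F] closure_Int_X0[of G]
    by (auto simp: rel_contact_def RC_pair_simps CO_simps)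
  then show ?thesis using closure_iso by simp
qed

text \<open>The term \<open>snd (canonical_algebra (X, X0, R))\<close> names the relation without
  spelling it out.\<close>

lemma canonical_algebra_iso:
  "precontact_iso (CO_sub X X0) (rel_contact X X0 R)
    (RC_pair X X0) (snd (canonical_algebra (X, X0, R))) ((closure_of) X)"
  using closure_pca_iso[of R] precontact_rel_contact[of X X0 R]
  by (intro precontact_isoI) (auto simp only: precontact_algebra_iff canonical_algebra.simps snd_conv)

end

text \<open>The homeomorphism acts by images on the clopen algebras of the dense subspaces, which it
  carries onto each other. Closures translate between these and the canonical algebras.\<close>

lemma pcs_isomorphic_canonical_algebra:
  assumes X: "topological_pair X X0" and Y: "topological_pair Y Y0"
    and f: "f \<in> pcs_iso (X, X0, R) (Y, Y0, S)"
  shows "pca_isomorphic (canonical_algebra (X, X0, R)) (canonical_algebra (Y, Y0, S))"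
proof -
  interpret X: top_pair X X0 by unfold_locales (rule X)
  interpret Y: top_pair Y Y0 by unfold_locales (rule Y)
  interpret clX: precontact_iso "CO_sub X X0" "rel_contact X X0 R"
    "RC_pair X X0" "snd (canonical_algebra (X, X0, R))" "(closure_of) X"
    by (rule X.canonical_algebra_iso)
  have hom: "homeomorphic_map X Y f" and f0: "f ` X0 = Y0"
    and rel: "\<And>x y. x \<in> X0 \<Longrightarrow> y \<in> X0 \<Longrightarrow> (x, y) \<in> R \<longleftrightarrow> (f x, f y) \<in> S"
    using f by auto
  have inj: "inj_on f X0"
    using hom X.subspace unfolding homeomorphic_map_def by (auto intro: inj_on_subset)
  have "f ` (topspace X \<inter> X0) = topspace Y \<inter> Y0"
    using f0 X.subspace Y.subspace by (simp add: Int_absorb1)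
  with hom have hom0: "homeomorphic_map (subtopology X X0) (subtopology Y Y0) f"
    by (rule homeomorphic_map_subtopologies)
  have clopen: "f ` F \<in> carrier (CO_sub Y Y0) \<longleftrightarrow> F \<in> carrier (CO_sub X X0)" if "F \<subseteq> X0" for F
    using homeomorphic_map_openness[OF hom0, of F] homeomorphic_map_closedness[OF hom0, of F]
      that X.topspace_X0 X.subspace by (auto simp: X.CO_simps Y.CO_simps)
  have "image f ` carrier (CO_sub X X0) = carrier (CO_sub Y Y0)"
  proof (intro equalityI subsetI)
    fix G assume G: "G \<in> carrier (CO_sub Y Y0)"
    define F where "F = {x \<in> X0. f x \<in> G}"
    have "G = f ` F" using Y.CO_subset[OF G] f0 by (auto simp: F_def)
    then show "G \<in> image f ` carrier (CO_sub X X0)" using clopen[of F] G by (auto simp: F_def)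
  qed (use clopen X.CO_subset in blast)
  moreover have "inj_on (image f) (carrier (CO_sub X X0))"
    using inj_on_image_Pow[OF inj] by (rule inj_on_subset) (use X.CO_subset in blast)
  moreover have "f ` (X0 - F) = Y0 - f ` F" "f ` (F \<inter> G) = f ` F \<inter> f ` G"
    if "F \<in> carrier (CO_sub X X0)" "G \<in> carrier (CO_sub X X0)" for F G
    using inj_on_image_set_diff[OF inj, of X0 F] inj_on_image_Int[OF inj, of F G] f0 X.CO_subset that
    by auto
  ultimately have "image f \<in> ba_iso (CO_sub X X0) (CO_sub Y Y0)"
    unfolding ba_iso_iff by (simp add: X.CO_simps(2-) Y.CO_simps(2-) bij_betw_def f0 image_Un)
  moreover have "(F, G) \<in> rel_contact X X0 R \<longleftrightarrow> (f ` F, f ` G) \<in> rel_contact Y Y0 S"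
    if "F \<in> carrier (CO_sub X X0)" "G \<in> carrier (CO_sub X X0)" for F G
  proof -
    have "F \<subseteq> X0" "G \<subseteq> X0" using that X.CO_subset by auto
    then show ?thesis using that clopen rel unfolding rel_contact_def by blast
  qed
  ultimately have "image f \<in> pca_iso (CO_sub X X0, rel_contact X X0 R) (CO_sub Y Y0, rel_contact Y Y0 S)"
    by simp
  \<comment> \<open>Recover the clopen set from its closure in \<open>X\<close>, move it by
    \<open>f\<close>, and close it again in \<open>Y\<close>.\<close>
  then have "((closure_of) Y \<circ> image f) \<circ> inv_into (carrier (CO_sub X X0)) ((closure_of) X)
      \<in> pca_iso (canonical_algebra (X, X0, R)) (canonical_algebra (Y, Y0, S))"
    using clX.inverse_pca_iso Y.closure_pca_iso[of S]
    by (simp only: canonical_algebra.simps snd_conv) (blast intro: pca_iso_comp)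
  then show ?thesis unfolding pca_isomorphic_def by blast
qed

section \<open>The canonical space of a precontact algebra\<close>

text \<open>Idempotence makes the closure of the interior of any set regular closed; it supplies the
  candidate infimum in the completeness proof.\<close>

lemma closure_interior_idem:
  "X closure_of (X interior_of (X closure_of (X interior_of S))) = X closure_of (X interior_of S)"
proof
  show "X closure_of (X interior_of (X closure_of (X interior_of S))) \<subseteq> X closure_of (X interior_of S)"
    by (intro closure_of_minimal interior_of_subset closedin_closure_of)
  have "X interior_of S \<subseteq> X interior_of (X closure_of (X interior_of S))"
    by (intro interior_of_maximal closure_of_subset interior_of_subset_topspace openin_interior_of)
  then show "X closure_of (X interior_of S) \<subseteq> X closure_of (X interior_of (X closure_of (X interior_of S)))"
    by (rule closure_of_mono)
qed

section \<open>The Stone map and the order-theoretic form of completeness\<close>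

definition stone :: "'a boolalg \<Rightarrow> 'a \<Rightarrow> 'a set set" where
  "stone B a = {u \<in> Ult B. a \<in> u}"

context boolean_alg
begin

lemma stone_simps:
  "stone B \<zero> = {}" "stone B \<one> = Ult B"
  "a \<in> carrier B \<Longrightarrow> stone B (compl B a) = Ult B - stone B a"
  "a \<in> carrier B \<Longrightarrow> b \<in> carrier B \<Longrightarrow> stone B (a \<otimes> b) = stone B a \<inter> stone B b"
  "a \<in> carrier B \<Longrightarrow> b \<in> carrier B \<Longrightarrow> stone B (a \<oplus> b) = stone B a \<union> stone B b"
  by (auto simp: stone_def Ult_simps)

lemma stone_subset_iff:
  "a \<in> carrier B \<Longrightarrow> b \<in> carrier B \<Longrightarrow> stone B a \<subseteq> stone B b \<longleftrightarrow> ba_le B a b"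
  by (auto simp: stone_def le_iff_Ult)

lemma stone_inj: "inj_on (stone B) (carrier B)"
proof (rule inj_onI)
  fix a b assume "a \<in> carrier B" "b \<in> carrier B" "stone B a = stone B b"
  then show "a = b"
    using stone_subset_iff[of a b] stone_subset_iff[of b a] le_antisym[of a b] by simp
qed

lemma partial_order_ba_order: "partial_order (ba_order B)"
  by (unfold_locales) (auto simp: ba_order_def le_refl intro: le_antisym le_trans)

lemma ba_greatest_iff:
  "greatest (ba_order B) i (Lower (ba_order B) S) \<longleftrightarrow>
    i \<in> carrier B \<and> (\<forall>a\<in>S \<inter> carrier B. ba_le B i a) \<and>
    (\<forall>b\<in>carrier B. (\<forall>a\<in>S \<inter> carrier B. ba_le B b a) \<longrightarrow> ba_le B b i)"
  by (auto simp: greatest_def Lower_def ba_order_def)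

text \<open>The greatest element is \<open>\<one>\<close>; in its presence infima of non-empty sets
  suffice, because suprema are infima of sets of upper bounds.\<close>

lemma ba_completeI:
  assumes "\<And>S. S \<subseteq> carrier B \<Longrightarrow> S \<noteq> {} \<Longrightarrow> \<exists>i\<in>carrier B. (\<forall>a\<in>S. ba_le B i a) \<and>
    (\<forall>b\<in>carrier B. (\<forall>a\<in>S. ba_le B b a) \<longrightarrow> ba_le B b i)"
  shows "ba_complete B"
  unfolding ba_complete_def
proof (rule partial_order.complete_lattice_criterion1[OF partial_order_ba_order])
  show "\<exists>g. greatest (ba_order B) g (carrier (ba_order B))"
    by (rule exI[of _ \<one>]) (auto simp: greatest_def ba_order_def le_one)
  fix S assume S: "S \<subseteq> carrier (ba_order B)" "S \<noteq> {}"
  then have "S \<subseteq> carrier B" by (simp add: ba_order_def)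
  then show "\<exists>i. greatest (ba_order B) i (Lower (ba_order B) S)"
    using assms[OF _ S(2)] unfolding ba_greatest_iff by (simp add: Int_absorb2) blast
qed

lemma ba_complete_inf:
  assumes "ba_complete B" "S \<subseteq> carrier B"
  obtains i where "i \<in> carrier B" "\<And>a. a \<in> S \<Longrightarrow> ba_le B i a"
    "\<And>b. b \<in> carrier B \<Longrightarrow> (\<And>a. a \<in> S \<Longrightarrow> ba_le B b a) \<Longrightarrow> ba_le B b i"
proof -
  interpret L: complete_lattice "ba_order B" using assms(1) by (simp add: ba_complete_def)
  have "S \<subseteq> carrier (ba_order B)" using assms(2) by (simp add: ba_order_def)
  then obtain i where "greatest (ba_order B) i (Lower (ba_order B) S)" using L.inf_exists by blast
  then show ?thesis
    using assms(2) unfolding ba_greatest_iff by (intro that[of i]) (auto simp: Int_absorb2)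
qed

end

section \<open>The topology on clans and its closed base\<close>

locale clan_space = precontact +
  fixes X g
  defines "X \<equiv> clan_topology (B, C)" and "g \<equiv> gmap (B, C)"
begin

lemma mem_g: "\<Gamma> \<in> g a \<longleftrightarrow> \<Gamma> \<in> Clans (B, C) \<and> a \<in> \<Gamma>"
  by (simp add: g_def gmap_def)

lemma g_join: "a \<in> carrier B \<Longrightarrow> b \<in> carrier B \<Longrightarrow> g (a \<oplus> b) = g a \<union> g b"
  using clan_join by (auto simp: mem_g)

lemma g_zero: "g \<zero> = {}" and g_one: "g \<one> = Clans (B, C)"
  using clanD(2,3) by (auto simp: mem_g)

lemma g_Int_Ult: "g a \<inter> Ult B = stone B a"
  using Ult_clan by (auto simp: mem_g stone_def)

lemma g_subset: "g a \<subseteq> Clans (B, C)"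
  by (auto simp: mem_g)

text \<open>The union law \<open>g_join\<close> makes the complements of the sets \<open>g a\<close>
  closed under binary intersections, so arbitrary unions of them form a topology.\<close>

lemma openin_iff: "openin X U \<longleftrightarrow>
    (arbitrary union_of (\<lambda>U. \<exists>a\<in>carrier B. U = Clans (B, C) - g a)) U"
proof -
  let ?P = "\<lambda>U. \<exists>a\<in>carrier B. U = Clans (B, C) - g a"
  have "istopology (arbitrary union_of ?P)"
  proof (rule istopology_base)
    fix S T assume "?P S" "?P T"
    then obtain a b where ab: "a \<in> carrier B" "b \<in> carrier B" "S = Clans (B, C) - g a" "T = Clans (B, C) - g b"
      by blast
    then have "S \<inter> T = Clans (B, C) - g (a \<oplus> b)" by (auto simp: g_join)
    then show "?P (S \<inter> T)" using ab by blast
  qed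
  then show ?thesis by (simp add: X_def clan_topology.simps g_def)
qed

lemma openin_basicE:
  assumes "openin X U" "\<Gamma> \<in> U"
  obtains a where "a \<in> carrier B" "\<Gamma> \<in> Clans (B, C) - g a" "Clans (B, C) - g a \<subseteq> U"
proof -
  obtain \<U> where \<U>: "\<U> \<subseteq> {U. \<exists>a\<in>carrier B. U = Clans (B, C) - g a}" "\<Union>\<U> = U"
    using assms(1) unfolding openin_iff union_of_def by auto
  have "\<Gamma> \<in> \<Union>\<U>" using assms(2) \<U>(2) by simp
  then obtain V where V: "V \<in> \<U>" "\<Gamma> \<in> V" by blast
  then have "V \<in> {U. \<exists>a\<in>carrier B. U = Clans (B, C) - g a}" using subsetD[OF \<U>(1)] by simp
  then obtain a where "a \<in> carrier B" "V = Clans (B, C) - g a" by auto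
  moreover have "V \<subseteq> U" using V(1) \<U>(2) by (simp add: Union_upper flip: \<U>(2))
  ultimately show ?thesis using that[of a] V(2) by simp
qed

lemma openin_basic: "a \<in> carrier B \<Longrightarrow> openin X (Clans (B, C) - g a)"
  unfolding openin_iff by (rule arbitrary_union_of_inc) blast

lemma topspace_X: "topspace X = Clans (B, C)"
proof
  have "openin X (topspace X)" by simp
  then show "topspace X \<subseteq> Clans (B, C)"
    by (meson DiffD1 openin_basicE subsetI)
  show "Clans (B, C) \<subseteq> topspace X"
    using openin_subset[OF openin_basic[of \<zero>]] by (simp add: g_zero)
qed

lemma closedin_g: "a \<in> carrier B \<Longrightarrow> closedin X (g a)"
  unfolding closedin_def topspace_X using openin_basic g_subset by blast

lemma closed_base_g: "closed_base X (g ` carrier B)"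
  unfolding closed_base_def
proof (intro conjI ballI allI impI)
  fix S assume "closedin X S"
  then have S: "S \<subseteq> Clans (B, C)" "openin X (Clans (B, C) - S)"
    by (auto simp: closedin_def topspace_X)
  \<comment> \<open>All basic sets containing \<open>S\<close>. A clan outside \<open>S\<close> has
    a basic neighbourhood missing \<open>S\<close>, whose complement is one of them and omits the
    clan.\<close>
  define \<G> where "\<G> = {F \<in> g ` carrier B. S \<subseteq> F}"
  have "\<Gamma> \<in> S" if \<Gamma>: "\<Gamma> \<in> Clans (B, C)" "\<Gamma> \<in> \<Inter>\<G>" for \<Gamma>
  proof (rule ccontr)
    assume "\<Gamma> \<notin> S"
    then obtain a where a: "a \<in> carrier B" "\<Gamma> \<in> Clans (B, C) - g a" "Clans (B, C) - g a \<subseteq> Clans (B, C) - S"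
      using openin_basicE[OF S(2), of \<Gamma>] \<Gamma>(1) by blast
    then have "S \<subseteq> g a" using S(1) by blast
    then have "g a \<in> \<G>" using a(1) by (simp add: \<G>_def)
    then show False using \<Gamma>(2) a(2) by blast
  qed
  then have "S = topspace X \<inter> \<Inter>\<G>" using S(1) unfolding topspace_X \<G>_def by auto
  then show "\<exists>\<G>\<subseteq>g ` carrier B. S = topspace X \<inter> \<Inter>\<G>" by (intro exI[of _ \<G>]) (simp add: \<G>_def)
qed (use closedin_g in auto)

lemma Ult_subset_Clans: "Ult B \<subseteq> Clans (B, C)"
  using Ult_clan by blast

lemma g_mono: "ba_le B a b \<Longrightarrow> b \<in> carrier B \<Longrightarrow> g a \<subseteq> g b"
  using clanD(4) by (auto simp: mem_g)

lemma g_le_iff: "a \<in> carrier B \<Longrightarrow> b \<in> carrier B \<Longrightarrow> g a \<subseteq> g b \<longleftrightarrow> ba_le B a b"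
  using g_mono[of a b] stone_subset_iff[of a b] g_Int_Ult[of a] g_Int_Ult[of b] by blast

lemma g_eq_iff: "a \<in> carrier B \<Longrightarrow> b \<in> carrier B \<Longrightarrow> g a = g b \<longleftrightarrow> a = b"
  using g_le_iff[of a b] g_le_iff[of b a] le_antisym[of a b] by auto

text \<open>For \<open>b\<close> in the algebra, both \<open>stone B a \<subseteq> g b\<close> and
  \<open>g a \<subseteq> g b\<close> mean \<open>ba_le B a b\<close>. The basic sets above
  \<open>stone B a\<close> are thus those above \<open>g a\<close>, and \<open>g a\<close> is the
  least of them.\<close>

lemma closure_stone:
  assumes a: "a \<in> carrier B" shows "X closure_of stone B a = g a"
proof -
  have "stone B a \<subseteq> g b \<longleftrightarrow> g a \<subseteq> g b" if b: "b \<in> carrier B" for b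
    using g_le_iff[OF a b] stone_subset_iff[OF a b] g_Int_Ult[of a] g_Int_Ult[of b] by blast
  moreover have "stone B a \<subseteq> topspace X" using Ult_subset_Clans by (auto simp: stone_def topspace_X)
  ultimately have "X closure_of stone B a = {\<Gamma> \<in> Clans (B, C). \<forall>b\<in>carrier B. g a \<subseteq> g b \<longrightarrow> \<Gamma> \<in> g b}"
    using closed_base_closure[OF closed_base_g] by (simp add: topspace_X)
  also have "\<dots> = g a" using a g_subset[of a] by (auto dest: bspec[OF _ a])
  finally show ?thesis .
qed

text \<open>Density is the case \<open>a = \<one>\<close> of \<open>closure_stone\<close>.\<close>

lemma topological_pair: "topological_pair X (Ult B)"
  using closure_stone[of \<one>] Ult_subset_Clans
  by (simp add: topological_pair_def topspace_X g_one stone_simps)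

sublocale pair: top_pair X "Ult B"
  by unfold_locales (rule topological_pair)

section \<open>The Stone space of ultrafilters\<close>

abbreviation "T \<equiv> subtopology X (Ult B)"

lemma clopen_stone: "a \<in> carrier B \<Longrightarrow> stone B a \<in> carrier (CO_sub X (Ult B))"
proof -
  have closed: "closedin T (stone B a)" if "a \<in> carrier B" for a
    using closedin_g[OF that] unfolding closedin_subtopology g_Int_Ult[symmetric] by blast
  show "stone B a \<in> carrier (CO_sub X (Ult B))" if "a \<in> carrier B"
    using closed[OF that] closed[OF compl_closed[OF that]] that
    unfolding pair.CO_simps mem_Collect_eq openin_closedin_eq pair.topspace_X0
    by (simp add: stone_simps) (simp add: stone_def)
qed

lemma openin_stone: "a \<in> carrier B \<Longrightarrow> openin T (stone B a)"
  using clopen_stone by (simp add: pair.CO_simps)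

text \<open>An ultrafilter that omits \<open>a\<close> contains its complement, so the trace of a
  basic open set of clans is again a Stone set.\<close>

lemma stone_base:
  assumes V: "openin T V" and u: "u \<in> V"
  obtains a where "a \<in> carrier B" "u \<in> stone B a" "stone B a \<subseteq> V"
proof -
  obtain W where W: "openin X W" "V = W \<inter> Ult B" using V by (auto simp: openin_subtopology)
  have uW: "u \<in> W" "u \<in> Ult B" using u W(2) by auto
  obtain a where a: "a \<in> carrier B" "u \<in> Clans (B, C) - g a" "Clans (B, C) - g a \<subseteq> W"
    using openin_basicE[OF W(1) uW(1)] .
  have eq: "(Clans (B, C) - g a) \<inter> Ult B = stone B (compl B a)"
    using g_Int_Ult[of a] Ult_subset_Clans a(1) by (auto simp: stone_simps)
  have "u \<in> stone B (compl B a)" "stone B (compl B a) \<subseteq> V"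
    using a(2,3) uW(2) W(2) unfolding eq[symmetric] by auto
  then show ?thesis using that[of "compl B a"] a(1) compl_closed by simp
qed

text \<open>If no finite subfamily covers the Stone space, then the elements whose Stone sets are not
  finitely covered contain an ultrafilter.\<close>

lemma compact_T: "compact_space T"
  unfolding compact_space_alt pair.topspace_X0
proof (intro allI impI)
  fix \<U> assume \<U>: "(\<forall>U\<in>\<U>. openin T U) \<and> Ult B \<subseteq> \<Union>\<U>"
  define cov where "cov S \<longleftrightarrow> (\<exists>\<F>. finite \<F> \<and> \<F> \<subseteq> \<U> \<and> S \<subseteq> \<Union>\<F>)" for S
  have cov_Un: "cov (S \<union> S')" if c: "cov S" "cov S'" for S S'
  proof -
    obtain \<F> where "finite \<F>" "\<F> \<subseteq> \<U>" "S \<subseteq> \<Union>\<F>" using c(1) unfolding cov_def by (elim exE conjE)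
    moreover obtain \<F>' where "finite \<F>'" "\<F>' \<subseteq> \<U>" "S' \<subseteq> \<Union>\<F>'"
      using c(2) unfolding cov_def by (elim exE conjE)
    ultimately show ?thesis unfolding cov_def by (intro exI[of _ "\<F> \<union> \<F>'"]) auto
  qed
  have cov_mono: "cov S" if "cov S'" "S \<subseteq> S'" for S S'
    using that unfolding cov_def by (meson order_trans)
  have "cov (Ult B)"
  proof (rule ccontr)
    assume no: "\<not> cov (Ult B)"
    obtain u where u: "u \<in> Ult B" "u \<subseteq> {a \<in> carrier B. \<not> cov (stone B a)}"
    proof (rule grill_ultrafilter[of \<one> "{a \<in> carrier B. \<not> cov (stone B a)}"])
      show "\<one> \<in> {a \<in> carrier B. \<not> cov (stone B a)}" using no by (simp add: stone_simps)
      show "\<zero> \<notin> {a \<in> carrier B. \<not> cov (stone B a)}"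
        unfolding cov_def by (auto simp: stone_simps intro: exI[of _ "{}"])
      fix a b
      show "b \<in> {a \<in> carrier B. \<not> cov (stone B a)}"
        if "a \<in> {a \<in> carrier B. \<not> cov (stone B a)}" "a \<in> carrier B" "b \<in> carrier B" "ba_le B a b"
        using that cov_mono[of "stone B b" "stone B a"] stone_subset_iff[of a b] by auto
      show "a \<in> {a \<in> carrier B. \<not> cov (stone B a)} \<or> b \<in> {a \<in> carrier B. \<not> cov (stone B a)}"
        if "a \<in> carrier B" "b \<in> carrier B" "a \<oplus> b \<in> {a \<in> carrier B. \<not> cov (stone B a)}"
        using that cov_Un[of "stone B a" "stone B b"] by (auto simp: stone_simps)
    qed simp_all
    \<comment> \<open>Some member \<open>U\<close> of the cover contains \<open>u\<close>. A Stone
      neighbourhood inside \<open>U\<close> is covered by that one set, although its index lies in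
      \<open>u\<close>.\<close>
    then obtain U where U: "U \<in> \<U>" "u \<in> U" "openin T U" using \<U> by blast
    obtain a where a: "a \<in> carrier B" "u \<in> stone B a" "stone B a \<subseteq> U"
      using stone_base[OF U(3,2)] by blast
    have "cov (stone B a)" unfolding cov_def using U(1) a(3) by (intro exI[of _ "{U}"]) auto
    moreover have "a \<in> u" using a(2) by (simp add: stone_def)
    ultimately show False using u(2) by blast
  qed
  then show "\<exists>\<F>. finite \<F> \<and> \<F> \<subseteq> \<U> \<and> Ult B \<subseteq> \<Union>\<F>" by (simp add: cov_def)
qed

lemma Ult_separated:
  assumes "u \<in> Ult B" "v \<in> Ult B" "u \<noteq> v"
  obtains a where "a \<in> carrier B" "u \<in> stone B a" "v \<in> stone B (compl B a)"
proof -
  have "\<not> u \<subseteq> v" using assms by (auto simp: Ult_def)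
  then obtain a where a: "a \<in> u" "a \<notin> v" by blast
  then have "a \<in> carrier B" using Ult_subset[OF assms(1)] by blast
  then show ?thesis using that[of a] a assms by (simp add: stone_def Ult_compl)
qed

lemma Stone_T: "Stone_space T"
  unfolding Stone_space_def
proof (intro conjI compact_T)
  show "Hausdorff_space T"
    unfolding Hausdorff_space_def pair.topspace_X0
  proof (intro allI impI)
    fix u v assume "u \<in> Ult B \<and> v \<in> Ult B \<and> u \<noteq> v"
    then obtain a where a: "a \<in> carrier B" "u \<in> stone B a" "v \<in> stone B (compl B a)"
      using Ult_separated by blast
    then show "\<exists>U V. openin T U \<and> openin T V \<and> u \<in> U \<and> v \<in> V \<and> disjnt U V"
      using openin_stone[OF a(1)] openin_stone[OF compl_closed[OF a(1)]]
      by (intro exI[of _ "stone B a"] exI[of _ "stone B (compl B a)"])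
        (auto simp: stone_simps disjnt_def)
  qed
  show "zero_dimensional T"
    unfolding zero_dimensional_def
  proof (intro allI impI)
    fix V u assume "openin T V \<and> u \<in> V"
    then obtain a where a: "a \<in> carrier B" "u \<in> stone B a" "stone B a \<subseteq> V"
      using stone_base by blast
    then show "\<exists>S. openin T S \<and> closedin T S \<and> u \<in> S \<and> S \<subseteq> V"
      using clopen_stone[OF a(1)] by (auto simp: pair.CO_simps)
  qed
qed

text \<open>Suppose \<open>V\<close> is not a Stone set. The \<open>a\<close> for which
  \<open>stone B a \<inter> V\<close> is not a Stone set form a grill and hence contain an
  ultrafilter \<open>u\<close>. As \<open>V\<close> is clopen, a small Stone neighbourhood of
  \<open>u\<close> lies inside \<open>V\<close> or misses it, and either way its intersection with
  \<open>V\<close> is a Stone set.\<close>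

lemma clopen_is_stone:
  assumes V: "V \<in> carrier (CO_sub X (Ult B))" shows "V \<in> stone B ` carrier B"
proof -
  let ?P = "\<lambda>S. S \<inter> V \<in> stone B ` carrier B"
  have "?P (Ult B)"
  proof (rule ccontr)
    assume no: "\<not> ?P (Ult B)"
    obtain u where u: "u \<in> Ult B" "u \<subseteq> {a \<in> carrier B. \<not> ?P (stone B a)}"
    proof (rule grill_ultrafilter[of \<one> "{a \<in> carrier B. \<not> ?P (stone B a)}"])
      show "\<one> \<in> {a \<in> carrier B. \<not> ?P (stone B a)}" using no by (simp add: stone_simps)
      have "stone B \<zero> \<inter> V = stone B \<zero>" by (simp add: stone_simps)
      then show "\<zero> \<notin> {a \<in> carrier B. \<not> ?P (stone B a)}" by (auto intro: rev_image_eqI)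
      fix a b
      show "b \<in> {a \<in> carrier B. \<not> ?P (stone B a)}"
        if "a \<in> {a \<in> carrier B. \<not> ?P (stone B a)}" "a \<in> carrier B" "b \<in> carrier B" "ba_le B a b"
      proof -
        have False if c: "c \<in> carrier B" "stone B b \<inter> V = stone B c" for c
        proof -
          have "stone B a \<inter> V = stone B (a \<otimes> c)"
            using \<open>ba_le B a b\<close> stone_subset_iff[of a b] \<open>a \<in> carrier B\<close> \<open>b \<in> carrier B\<close> c
            by (auto simp: stone_simps)
          then show False using \<open>a \<in> {a \<in> carrier B. \<not> ?P (stone B a)}\<close> c(1) by blast
        qed
        then show ?thesis using that(3) by blast
      qed
      show "a \<in> {a \<in> carrier B. \<not> ?P (stone B a)} \<or> b \<in> {a \<in> carrier B. \<not> ?P (stone B a)}"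
        if "a \<in> carrier B" "b \<in> carrier B" "a \<oplus> b \<in> {a \<in> carrier B. \<not> ?P (stone B a)}"
      proof -
        have False if cd: "c \<in> carrier B" "stone B a \<inter> V = stone B c" "d \<in> carrier B" "stone B b \<inter> V = stone B d" for c d
        proof -
          have "stone B (a \<oplus> b) \<inter> V = stone B (c \<oplus> d)"
            using \<open>a \<in> carrier B\<close> \<open>b \<in> carrier B\<close> cd by (auto simp: stone_simps)
          then show False using \<open>a \<oplus> b \<in> {a \<in> carrier B. \<not> ?P (stone B a)}\<close> cd(1,3) by blast
        qed
        then show ?thesis using that(1,2) by blast
      qed
    qed simp_all
    have op: "openin T V" "openin T (Ult B - V)"
      using V pair.topspace_X0 by (auto simp: pair.CO_simps closedin_def)
    obtain a where a: "a \<in> carrier B" "u \<in> stone B a" "stone B a \<subseteq> V \<or> stone B a \<subseteq> Ult B - V"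
    proof (cases "u \<in> V")
      case True
      show ?thesis by (rule stone_base[OF op(1) True]) (use that in blast)
    next
      case False
      then have "u \<in> Ult B - V" using u(1) by blast
      then show ?thesis by (rule stone_base[OF op(2)]) (use that in blast)
    qed
    then have "stone B a \<inter> V = stone B a \<or> stone B a \<inter> V = stone B \<zero>" by (auto simp: stone_simps)
    then have "?P (stone B a)" using a(1) by auto
    moreover have "a \<in> u" using a(2) by (simp add: stone_def)
    ultimately show False using u(2) by blast
  qed
  moreover have "Ult B \<inter> V = V" using pair.CO_subset[OF V] by blast
  ultimately show ?thesis by simp
qed

lemma stone_iso: "stone B \<in> pca_iso (B, C) (CO_sub X (Ult B), rel_contact X (Ult B) (ult_rel B C))"
proof -
  have "stone B ` carrier B = carrier (CO_sub X (Ult B))"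
    using clopen_stone clopen_is_stone by blast
  then have "stone B \<in> ba_iso B (CO_sub X (Ult B))"
    using stone_inj by (simp add: ba_iso_iff bij_betw_def pair.CO_simps(2-) stone_simps)
  moreover have "(a, b) \<in> C \<longleftrightarrow> (stone B a, stone B b) \<in> rel_contact X (Ult B) (ult_rel B C)"
    if "a \<in> carrier B" "b \<in> carrier B" for a b
  proof -
    have "(a, b) \<in> C \<longleftrightarrow> (\<exists>u\<in>stone B a. \<exists>v\<in>stone B b. (u, v) \<in> ult_rel B C)"
      unfolding C_iff_ult_rel[OF that] using ult_rel_Ult by (auto simp: stone_def)
    then show ?thesis using that clopen_stone by (simp add: rel_contact_def)
  qed
  ultimately show ?thesis by simp
qed

sublocale st: precontact_iso B C "CO_sub X (Ult B)" "rel_contact X (Ult B) (ult_rel B C)" "stone B"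
  by (unfold_locales) (rule stone_iso, auto simp: rel_contact_def)

section \<open>The canonical space and the map \<open>g\<close>\<close>

lemma carrier_RC_pair: "carrier (RC_pair X (Ult B)) = g ` carrier B"
  using st.surj closure_stone by (auto simp: RC_pair_simps simp flip: st.surj)

lemma g_iso: "g \<in> pca_iso (B, C) (canonical_algebra (X, Ult B, ult_rel B C))"
proof -
  let ?h = "(closure_of) X \<circ> stone B"
  have h: "?h \<in> pca_iso (B, C) (canonical_algebra (X, Ult B, ult_rel B C))"
    using pca_iso_comp[OF stone_iso pair.closure_pca_iso[unfolded canonical_algebra.simps]]
    by (simp only: canonical_algebra.simps)
  have eq: "g a = ?h a" if "a \<in> carrier B" for a using closure_stone[OF that] by simp
  \<comment> \<open>\<open>g\<close> and the composite agree on the carrier by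
    \<open>closure_stone\<close>, and bijectivity between the carriers depends on the values there
    alone.\<close>
  have "bij_betw ?h (carrier B) (carrier (RC_pair X (Ult B))) \<longleftrightarrow>
      bij_betw g (carrier B) (carrier (RC_pair X (Ult B)))"
    by (rule bij_betw_cong) (simp add: eq)
  then show ?thesis
    using h by (simp add: ba_iso_iff eq compl_closed del: comp_apply)
qed

text \<open>A clan, viewed as a point of the space, gives back its own image under
  \<open>stone B\<close>. This settles the axiom that all clans of the clopen algebra come from
  points.\<close>

lemma point_clan_eq:
  assumes "\<Gamma> \<in> Clans (B, C)" shows "point_clan X (Ult B) \<Gamma> = stone B ` \<Gamma>"
proof -
  have "\<Gamma> \<in> X closure_of stone B a \<longleftrightarrow> a \<in> \<Gamma>" if "a \<in> carrier B" for a
    using closure_stone[OF that] assms by (simp add: mem_g)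
  then show ?thesis
    using clanD(1)[OF assms] unfolding point_clan_def st.surj[symmetric] by blast
qed

lemma sharp_iff_Int:
  assumes "a \<in> carrier B" "b \<in> carrier B"
  shows "(a, b) \<in> sharp (B, C) \<longleftrightarrow> g a \<inter> g b \<noteq> {}"
proof -
  have "g a \<inter> g b = {\<Gamma> \<in> Clans (B, C). a \<in> \<Gamma> \<and> b \<in> \<Gamma>}"
    unfolding g_def gmap_def by auto
  then show ?thesis unfolding sharp_iff_clan[OF assms] by auto
qed

text \<open>An unrelated pair of ultrafilters has a witness \<open>(a, b)\<close> outside
  \<open>C\<close> with \<open>a\<close> in the first and \<open>b\<close> in the second; the
  product of the two Stone sets is an open rectangle avoiding the relation.\<close>

lemma closedin_ult_rel: "closedin (prod_topology T T) (ult_rel B C)"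
  unfolding closedin_def openin_prod_topology_alt topspace_prod_topology pair.topspace_X0
proof (intro conjI allI impI)
  show "ult_rel B C \<subseteq> Ult B \<times> Ult B" by (auto simp: ult_rel_def)
  fix u v assume "(u, v) \<in> Ult B \<times> Ult B - ult_rel B C"
  then obtain a b where ab: "u \<in> Ult B" "v \<in> Ult B" "a \<in> u" "b \<in> v" "(a, b) \<notin> C" by (auto simp: ult_rel_def)
  then have "a \<in> carrier B" "b \<in> carrier B" using Ult_subset by auto
  then have "openin T (stone B a)" "openin T (stone B b)" using openin_stone by auto
  moreover have "stone B a \<times> stone B b \<subseteq> Ult B \<times> Ult B - ult_rel B C"
    using ab(5) by (auto simp: stone_def ult_rel_def)
  moreover have "u \<in> stone B a" "v \<in> stone B b" using ab by (auto simp: stone_def)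
  ultimately show "\<exists>U V. openin T U \<and> openin T V \<and> u \<in> U \<and> v \<in> V \<and> U \<times> V \<subseteq> Ult B \<times> Ult B - ult_rel B C"
    by blast
qed

lemma t0: "t0_space X"
  unfolding t0_space_def topspace_X
proof (intro ballI impI)
  fix \<Gamma> \<Delta> assume \<Gamma>: "\<Gamma> \<in> Clans (B, C)" "\<Delta> \<in> Clans (B, C)" "\<Gamma> \<noteq> \<Delta>"
  then obtain a where a: "a \<in> carrier B" "a \<in> \<Gamma> \<longleftrightarrow> a \<notin> \<Delta>" using clanD(1) by blast
  then show "\<exists>U. openin X U \<and> (\<Gamma> \<notin> U) = (\<Delta> \<in> U)"
    using openin_basic[OF a(1)] \<Gamma> by (intro exI[of _ "Clans (B, C) - g a"]) (auto simp: mem_g)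
qed

lemma precontact_space: "precontact_space (X, Ult B, ult_rel B C)"
  unfolding precontact_space.simps
proof (intro conjI ballI impI)
  show "closed_base X (carrier (RC_pair X (Ult B)))"
    unfolding carrier_RC_pair by (rule closed_base_g)
  show "(F, G) \<in> sharp (CO_sub X (Ult B), rel_contact X (Ult B) (ult_rel B C))"
    if FG: "F \<in> carrier (CO_sub X (Ult B))" "G \<in> carrier (CO_sub X (Ult B))"
      and ne: "X closure_of F \<inter> X closure_of G \<noteq> {}" for F G
  proof -
    obtain a where a: "a \<in> carrier B" "F = stone B a" using clopen_is_stone[OF FG(1)] by (elim imageE)
    obtain b where b: "b \<in> carrier B" "G = stone B b" using clopen_is_stone[OF FG(2)] by (elim imageE)
    note ab = a b
    \<comment> \<open>The closures are \<open>g a\<close> and \<open>g b\<close>, so a common point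
      is a clan holding both elements.\<close>
    then have "(a, b) \<in> sharp (B, C)" using ne closure_stone sharp_iff_Int[of a b] by simp
    then show ?thesis using st.sharp_rel_iff[of a b] ab by simp
  qed
  show "\<exists>x\<in>topspace X. \<Gamma> = point_clan X (Ult B) x"
    if "\<Gamma> \<in> Clans (CO_sub X (Ult B), rel_contact X (Ult B) (ult_rel B C))" for \<Gamma>
  proof -
    note \<Gamma> = that
    obtain \<Delta> where "\<Delta> \<in> Clans (B, C)" "\<Gamma> = stone B ` \<Delta>"
      using \<Gamma> unfolding st.Clans_image[symmetric] by (elim imageE)
    then show ?thesis using point_clan_eq topspace_X by auto
  qed
qed (rule topological_pair t0 Stone_T closedin_ult_rel)+

lemma g_sharp_iso: "g \<in> pca_iso (B, sharp (B, C)) (RC_pair X (Ult B), pair_contact X (Ult B))"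
proof -
  have "(a, b) \<in> sharp (B, C) \<longleftrightarrow> (g a, g b) \<in> pair_contact X (Ult B)"
    if "a \<in> carrier B" "b \<in> carrier B" for a b
    using that sharp_iff_Int by (simp add: pair_contact_def carrier_RC_pair)
  then show ?thesis using g_iso by simp
qed

text \<open>The precontact laws are transported along \<open>g\<close>; reflexivity and symmetry are
  evident for a relation given by non-empty intersection.\<close>

lemma contact_algebra_RC_pair: "contact_algebra (RC_pair X (Ult B), pair_contact X (Ult B))"
proof -
  interpret sh: precontact_iso B "sharp (B, C)" "RC_pair X (Ult B)" "pair_contact X (Ult B)" g
    using precontact_sharp g_sharp_iso
    by (intro precontact_iso.intro precontact_iso_axioms.intro) (auto simp: pair_contact_def)
  have "Cref (RC_pair X (Ult B), pair_contact X (Ult B))" "Csym (RC_pair X (Ult B), pair_contact X (Ult B))"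
    by (auto simp: pair_contact_def RC_pair_simps)
  then show ?thesis
    using sh.precontact_image unfolding contact_algebra_def precontact_algebra_iff by blast
qed

section \<open>Connectedness\<close>

lemma g_compl: "a \<in> carrier B \<Longrightarrow> g (compl B a) = X closure_of (Clans (B, C) - g a)"
  using g_iso by (simp add: ba_iso_iff RC_pair_simps topspace_X)

text \<open>Since an element and its complement have zero meet, \<open>sharp\<close> between them
  reduces to \<open>C\<close> in one of the two orders. It fails exactly when \<open>g a\<close> and
  \<open>g (compl B a)\<close> are disjoint, and as they cover the space this makes
  \<open>g a\<close> clopen. Every clopen set arises so, being the closure of its trace on the
  ultrafilters.\<close>

lemma connected_iff: "Ccon (B, C) \<longleftrightarrow> connected_space X"
proof -
  have con: "(a, compl B a) \<in> C \<or> (compl B a, a) \<in> C \<longleftrightarrow> g a \<inter> g (compl B a) \<noteq> {}"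
    if "a \<in> carrier B" for a
    using that sharp_iff_Int[of a "compl B a"] by (simp add: compl_closed mult_compl)
  have gU: "g a \<union> g (compl B a) = Clans (B, C)" if "a \<in> carrier B" for a
    using g_join[of a "compl B a"] that by (simp add: compl_closed add_compl g_one)
  have g_eq: "g a = {} \<longleftrightarrow> a = \<zero>" "g a = Clans (B, C) \<longleftrightarrow> a = \<one>" if "a \<in> carrier B" for a
    using g_eq_iff[OF that, of \<zero>] g_eq_iff[OF that, of \<one>] by (simp_all add: g_zero g_one)
  show ?thesis
  proof
    assume C: "Ccon (B, C)"
    show "connected_space X"
      unfolding connected_space_clopen_in
    proof (intro allI impI)
      fix S assume S: "openin X S \<and> closedin X S"
      have "S \<inter> Ult B \<in> carrier (CO_sub X (Ult B))"
        using S by (auto simp: pair.CO_simps openin_subtopology closedin_subtopology)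
      then obtain a where a: "a \<in> carrier B" "S \<inter> Ult B = stone B a" using clopen_is_stone by blast
      have "S = g a"
        using pair.closure_Int_dense[of S] S closure_stone[OF a(1)] a(2) by (simp add: closure_of_closedin)
      moreover have "Clans (B, C) - S = g (compl B a)"
        using S g_compl[OF a(1)] \<open>S = g a\<close> by (simp add: closure_of_closedin closedin_diff topspace_X[symmetric])
      ultimately have "a = \<zero> \<or> a = \<one>" using C con[OF a(1)] a(1) by auto
      then show "S = {} \<or> S = topspace X" using \<open>S = g a\<close> by (auto simp: g_zero g_one topspace_X)
    qed
  next
    assume conn: "connected_space X"
    have "(a, compl B a) \<in> C \<or> (compl B a, a) \<in> C" if a: "a \<in> carrier B" "a \<noteq> \<zero>" "a \<noteq> \<one>" for a
    proof (rule ccontr)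
      assume "\<not> ?thesis"
      then have "g a \<inter> g (compl B a) = {}" using con a by blast
      then have "g a = Clans (B, C) - g (compl B a)" using gU[OF a(1)] by blast
      then have "openin X (g a)" using openin_basic[OF compl_closed[OF a(1)]] by simp
      moreover have "closedin X (g a)" using closedin_g[OF a(1)] .
      ultimately show False using conn g_eq[OF a(1)] a unfolding connected_space_clopen_in topspace_X by blast
    qed
    then show "Ccon (B, C)" by simp
  qed
qed

section \<open>Regular closed sets and completeness\<close>

lemma g_regular: "a \<in> carrier B \<Longrightarrow> g a \<in> carrier (RC X)"
proof -
  assume a: "a \<in> carrier B"
  \<comment> \<open>By \<open>g_compl\<close>, the complement of \<open>g (compl B a)\<close> is the
    interior of \<open>g a\<close>; closing that interior and using \<open>g_compl\<close> again
    returns \<open>g a\<close>.\<close>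
  have "topspace X - X closure_of (Clans (B, C) - g a) = X interior_of g a"
    using interior_of_closure_of[of X "g a"] by (simp add: topspace_X)
  then have "Clans (B, C) - g (compl B a) = X interior_of g a"
    using g_compl[OF a] by (simp add: topspace_X)
  then have "g a = X closure_of (X interior_of g a)"
    using g_compl[OF compl_closed[OF a]] compl_compl[OF a] by simp
  then show ?thesis using g_subset by (auto simp: RC_def topspace_X)
qed

lemma RC_pair_subset: "carrier (RC_pair X (Ult B)) \<subseteq> carrier (RC X)"
  using g_regular by (auto simp: carrier_RC_pair)

lemma complete_iff: "carrier (RC X) = carrier (RC_pair X (Ult B)) \<longleftrightarrow> ba_complete B"
proof
  assume eq: "carrier (RC X) = carrier (RC_pair X (Ult B))"
  show "ba_complete B"
  proof (rule ba_completeI)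
    fix S assume S: "S \<subseteq> carrier B" "S \<noteq> {}"
    \<comment> \<open>The infimum of the sets \<open>g a\<close> among regular closed sets; their
      intersection itself need not be regular closed.\<close>
    define F where "F = X closure_of (X interior_of (\<Inter>(g ` S)))"
    have reg: "X closure_of (X interior_of F) = F"
      unfolding F_def by (rule closure_interior_idem)
    have "F \<in> carrier (RC X)" using reg by (simp add: RC_def) (simp add: F_def closure_of_subset_topspace)
    then obtain i where i: "i \<in> carrier B" "F = g i" using eq carrier_RC_pair by auto
    have "g i \<subseteq> g a" if "a \<in> S" for a
    proof -
      have "X interior_of (\<Inter>(g ` S)) \<subseteq> g a" using interior_of_subset[of X "\<Inter>(g ` S)"] that by blast
      then show ?thesis using closure_of_minimal closedin_g S(1) that i(2) unfolding F_def by blast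
    qed
    moreover have "g b \<subseteq> g i" if b: "b \<in> carrier B" "\<And>a. a \<in> S \<Longrightarrow> g b \<subseteq> g a" for b
    proof -
      have "g b = X closure_of (X interior_of (g b))" using g_regular[OF b(1)] by (simp add: RC_def)
      moreover have "g b \<subseteq> \<Inter>(g ` S)" using b(2) by blast
      ultimately show ?thesis
        unfolding i(2)[symmetric] F_def by (metis closure_of_mono interior_of_mono)
    qed
    ultimately show "\<exists>i\<in>carrier B. (\<forall>a\<in>S. ba_le B i a) \<and>
        (\<forall>b\<in>carrier B. (\<forall>a\<in>S. ba_le B b a) \<longrightarrow> ba_le B b i)"
      using i(1) S(1) g_le_iff by (intro bexI[of _ i]) (auto simp: subset_iff)
  qed
next
  assume comp: "ba_complete B"
  have "F \<in> g ` carrier B" if F: "F \<in> carrier (RC X)" for F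
  proof -
    have F_reg: "F = X closure_of (X interior_of F)" using F by (simp add: RC_def)
    \<comment> \<open>\<open>F\<close> is the intersection of the \<open>g a\<close> with
      \<open>a\<close> in \<open>S\<close>, so the infimum of \<open>S\<close> is the only candidate
      for its index.\<close>
    define S where "S = {a \<in> carrier B. F \<subseteq> g a}"
    obtain i where i: "i \<in> carrier B" "\<And>a. a \<in> S \<Longrightarrow> ba_le B i a"
      "\<And>b. b \<in> carrier B \<Longrightarrow> (\<And>a. a \<in> S \<Longrightarrow> ba_le B b a) \<Longrightarrow> ba_le B b i"
      by (rule ba_complete_inf[OF comp, of S]) (auto simp: S_def)
    have clF: "closedin X F" using F_reg by (metis closedin_closure_of)
    then have F_sub: "F \<subseteq> topspace X" by (rule closedin_subset)
    have F_eq: "F = {\<Gamma> \<in> topspace X. \<forall>a\<in>S. \<Gamma> \<in> g a}"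
      using closed_base_closure[OF closed_base_g F_sub] closure_of_closedin[OF clF]
      by (auto simp: S_def)
    have "g i \<subseteq> F"
      unfolding F_eq topspace_X using g_mono[OF i(2)] g_subset by (auto simp: S_def)
    moreover have "X interior_of F \<subseteq> g i"
    proof (rule ccontr)
      assume no: "\<not> ?thesis"
      \<comment> \<open>If the interior of \<open>F\<close> is not inside \<open>g i\<close>, a
        basic open part \<open>V\<close> of the difference closes up to
        \<open>g (compl B a)\<close>, which lies in \<open>F\<close>. So \<open>compl B a\<close> is
        a lower bound of \<open>S\<close>, and \<open>V\<close> falls into \<open>g i\<close> after
        all.\<close>
      define U where "U = X interior_of F - g i"
      have "openin X U" using closedin_g i(1) by (auto simp: U_def openin_diff)
      moreover obtain \<Gamma> where "\<Gamma> \<in> U" using no by (auto simp: U_def)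
      ultimately obtain a where a: "a \<in> carrier B" "\<Gamma> \<in> Clans (B, C) - g a" "Clans (B, C) - g a \<subseteq> U"
        by (rule openin_basicE)
      define V where "V = Clans (B, C) - g a"
      have V: "V = Clans (B, C) - g a" "V \<noteq> {}" "V \<subseteq> U" using a(2,3) by (auto simp: V_def)
      have "V \<subseteq> F" using interior_of_subset[of X F] V(3) by (auto simp: U_def)
      then have "g (compl B a) \<subseteq> F"
        using closure_of_minimal[OF _ clF] g_compl[OF a(1)] V(1) by simp
      then have "ba_le B (compl B a) c" if "c \<in> S" for c
        using that g_le_iff[OF compl_closed[OF a(1)], of c] by (auto simp: S_def)
      then have "g (compl B a) \<subseteq> g i" using i(1,3) compl_closed[OF a(1)] g_mono by blast
      moreover have "V \<subseteq> g (compl B a)"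
        using g_compl[OF a(1)] closure_of_subset[of V X] V(1) topspace_X by auto
      ultimately show False using V(2,3) by (auto simp: U_def)
    qed
    then have "F \<subseteq> g i" using closure_of_minimal[OF _ closedin_g[OF i(1)]] F_reg by metis
    ultimately show ?thesis using i(1) by blast
  qed
  then show "carrier (RC X) = carrier (RC_pair X (Ult B))" using RC_pair_subset carrier_RC_pair by blast
qed

end

section \<open>Duality\<close>

text \<open>By \<open>gmap_image\<close> the image map carries one closed base onto the other, which
  settles the topology.\<close>

lemma (in precontact_iso) canonical_space_iso:
  "image h \<in> pcs_iso (canonical_space (A, C)) (canonical_space (B, C'))"
proof -
  interpret X: clan_space A C "clan_topology (A, C)" "gmap (A, C)"
    by (rule clan_space.intro) (rule precontact_axioms)
  interpret Y: clan_space B C' "clan_topology (B, C')" "gmap (B, C')"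
    by (rule clan_space.intro) (rule precontact_image)
  have "gmap (B, C') ` carrier B = image (image h) ` gmap (A, C) ` carrier A"
    unfolding surj[symmetric] image_image using gmap_image by (intro image_cong) auto
  then have "homeomorphic_map (clan_topology (A, C)) (clan_topology (B, C')) (image h)"
    using Clans_bij
    by (intro closed_base_homeomorphic_map[OF _ X.closed_base_g Y.closed_base_g])
      (simp_all add: X.topspace_X Y.topspace_X)
  then show ?thesis
    using Ult_bij ult_rel_image by (simp add: canonical_space_eq del: canonical_space.simps)
qed

lemma pcs_isomorphic_canonical_space:
  assumes "precontact_algebra A" "precontact_algebra A'" "pca_isomorphic A A'"
  shows "pcs_isomorphic (canonical_space A) (canonical_space A')"
proof -
  obtain B C B' C' where A: "A = (B, C)" "A' = (B', C')" by fastforce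
  then obtain h where h: "h \<in> pca_iso (B, C) (B', C')" using assms(3) by (auto simp: pca_isomorphic_def)
  interpret B': precontact B' C' using assms(2) by (simp only: A precontact_algebra_iff)
  interpret precontact_iso B C B' C' h
    by (rule precontact_isoI) (use assms(1) h B'.C_subset in \<open>simp_all only: A\<close>)
  show ?thesis using canonical_space_iso unfolding A pcs_isomorphic_def by blast
qed

section \<open>Points of a 2-precontact space as clans\<close>

locale pc_space = top_pair +
  fixes R
  assumes pcs: "precontact_space (X, X0, R)"
begin

abbreviation "T \<equiv> subtopology X X0"

lemma pcsD:
  "t0_space X" "compact_space T" "Hausdorff_space T" "zero_dimensional T"
  "closedin (prod_topology T T) R" "closed_base X (carrier (RC_pair X X0))"
  using pcs by (simp_all add: Stone_space_def)

lemma closure_meets_sharp: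
  assumes "F \<in> carrier (CO_sub X X0)" "G \<in> carrier (CO_sub X X0)" "X closure_of F \<inter> X closure_of G \<noteq> {}"
  shows "(F, G) \<in> sharp (CO_sub X X0, rel_contact X X0 R)"
proof -
  have "\<forall>F\<in>carrier (CO_sub X X0). \<forall>G\<in>carrier (CO_sub X X0). X closure_of F \<inter> X closure_of G \<noteq> {} \<longrightarrow>
      (F, G) \<in> sharp (CO_sub X X0, rel_contact X X0 R)"
    using pcs unfolding precontact_space.simps by (elim conjE)
  then show ?thesis using assms by blast
qed

lemma clan_is_point:
  assumes "\<Gamma> \<in> Clans (CO_sub X X0, rel_contact X X0 R)"
  obtains x where "x \<in> topspace X" "\<Gamma> = point_clan X X0 x"
proof -
  have "\<forall>\<Gamma>\<in>Clans (CO_sub X X0, rel_contact X X0 R). \<exists>x\<in>topspace X. \<Gamma> = point_clan X X0 x"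
    using pcs unfolding precontact_space.simps by (elim conjE)
  then show ?thesis using assms that by blast
qed

sublocale CO: precontact "CO_sub X X0" "rel_contact X X0 R"
  by (rule precontact_rel_contact)

sublocale cl: precontact_iso "CO_sub X X0" "rel_contact X X0 R"
    "RC_pair X X0" "snd (canonical_algebra (X, X0, R))" "(closure_of) X"
  by (rule canonical_algebra_iso)

text \<open>The canonical space of the canonical algebra, the target of the map
  \<open>point\<close>.\<close>

sublocale clan: clan_space "RC_pair X X0" "snd (canonical_algebra (X, X0, R))"
    "clan_topology (RC_pair X X0, snd (canonical_algebra (X, X0, R)))"
    "gmap (RC_pair X X0, snd (canonical_algebra (X, X0, R)))"
  by (rule clan_space.intro) (rule cl.precontact_image)

lemma point_clan_iff: "F \<in> point_clan X X0 x \<longleftrightarrow> F \<in> carrier (CO_sub X X0) \<and> x \<in> X closure_of F"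
  by (simp add: point_clan_def)

text \<open>Closure commutes with binary unions, which gives primeness; compatibility of the members
  is the axiom on meeting closures.\<close>

lemma point_clan_clan:
  assumes x: "x \<in> topspace X" shows "point_clan X X0 x \<in> Clans (CO_sub X X0, rel_contact X X0 R)"
  unfolding Clans.simps mem_Collect_eq
proof (intro conjI ballI impI)
  show "point_clan X X0 x \<subseteq> carrier (CO_sub X X0)" by (auto simp: point_clan_iff)
  have "\<one>\<^bsub>CO_sub X X0\<^esub> \<in> point_clan X X0 x" using x CO.one_closed unfolding point_clan_iff CO_simps(3) dense by blast
  then show "point_clan X X0 x \<noteq> {}" by blast
  show "\<zero>\<^bsub>CO_sub X X0\<^esub> \<notin> point_clan X X0 x" by (simp add: point_clan_iff CO_simps)
  show "G \<in> point_clan X X0 x"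
    if "F \<in> point_clan X X0 x" "G \<in> carrier (CO_sub X X0)" "ba_le (CO_sub X X0) F G" for F G
    using that closure_of_mono[of F G X] by (auto simp: point_clan_iff ba_le_def CO_simps(4))
  show "F \<in> point_clan X X0 x \<or> G \<in> point_clan X X0 x"
    if "F \<in> carrier (CO_sub X X0)" "G \<in> carrier (CO_sub X X0)" "F \<oplus>\<^bsub>CO_sub X X0\<^esub> G \<in> point_clan X X0 x" for F G
    using that by (auto simp: point_clan_iff CO_simps(5))
  show "(F, G) \<in> sharp (CO_sub X X0, rel_contact X X0 R)"
    if "F \<in> point_clan X X0 x" "G \<in> point_clan X X0 x" for F G
    using that by (intro closure_meets_sharp) (auto simp: point_clan_iff)
qed

text \<open>The clan of all members of \<open>RC_pair X X0\<close> through \<open>x\<close>, as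
  \<open>mem_point\<close> shows. Written as an image along the closure isomorphism, it is open to
  \<open>cl.Clans_image\<close> and \<open>cl.Ult_bij\<close>.\<close>

definition "point x = (closure_of) X ` point_clan X X0 x"

lemma mem_point: "F \<in> carrier (RC_pair X X0) \<Longrightarrow> F \<in> point x \<longleftrightarrow> x \<in> F"
  unfolding RC_pair_simps(1) point_def point_clan_def by auto

text \<open>Points with equal clans lie in the same basic sets, hence in the same closed and open
  sets, and T0 identifies them. Surjectivity is the axiom that each clan of the clopen algebra comes
  from a point, transported along closure.\<close>

lemma point_bij:
  "bij_betw point (topspace X) (Clans (RC_pair X X0, snd (canonical_algebra (X, X0, R))))"
  unfolding bij_betw_def
proof
  show "inj_on point (topspace X)"
  proof (rule inj_onI)
    fix x y assume xy: "x \<in> topspace X" "y \<in> topspace X" "point x = point y"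
    have "x \<in> S \<longleftrightarrow> y \<in> S" if S: "closedin X S" for S
    proof -
      obtain \<G> where \<G>: "\<G> \<subseteq> carrier (RC_pair X X0)" "S = topspace X \<inter> \<Inter>\<G>"
        using pcsD(6) S unfolding closed_base_def by blast
      have "x \<in> F \<longleftrightarrow> y \<in> F" if "F \<in> \<G>" for F
        using mem_point[of F x] mem_point[of F y] xy(3) subsetD[OF \<G>(1) that] by simp
      then show ?thesis using xy(1,2) \<G>(2) by auto
    qed
    then have "x \<in> U \<longleftrightarrow> y \<in> U" if "openin X U" for U
      using that xy(1,2) by (metis DiffD2 DiffI openin_closedin_eq)
    then show "x = y" using pcsD(1) xy(1,2) unfolding t0_space_def by metis
  qed
  have "point_clan X X0 ` topspace X = Clans (CO_sub X X0, rel_contact X X0 R)"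
  proof (intro equalityI subsetI)
    fix \<Gamma> assume "\<Gamma> \<in> Clans (CO_sub X X0, rel_contact X X0 R)"
    then show "\<Gamma> \<in> point_clan X X0 ` topspace X" by (rule clan_is_point) blast
  qed (use point_clan_clan in auto)
  then show "point ` topspace X = Clans (RC_pair X X0, snd (canonical_algebra (X, X0, R)))"
    unfolding cl.Clans_image[symmetric] by (simp add: point_def[abs_def] flip: image_image)
qed

text \<open>As \<open>F\<close> belongs to \<open>point x\<close> iff \<open>x\<close> belongs to
  \<open>F\<close>, the map carries each basic set onto the basic set of clans with the same
  index.\<close>

lemma point_homeomorphic:
  "homeomorphic_map X (clan_topology (RC_pair X X0, snd (canonical_algebra (X, X0, R)))) point"
proof (rule closed_base_homeomorphic_map[OF _ pcsD(6) clan.closed_base_g])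
  show "bij_betw point (topspace X) (topspace (clan_topology (RC_pair X X0, snd (canonical_algebra (X, X0, R)))))"
    unfolding clan.topspace_X by (rule point_bij)
  have "gmap (RC_pair X X0, snd (canonical_algebra (X, X0, R))) F = point ` F"
    if F: "F \<in> carrier (RC_pair X X0)" for F
  proof -
    have "F \<subseteq> topspace X" using F closure_of_subset_topspace[of X] by (fastforce simp: RC_pair_simps)
    then have "point ` F = {\<Gamma> \<in> point ` topspace X. F \<in> \<Gamma>}"
      using mem_point[OF F] by auto
    then show ?thesis using point_bij by (simp add: gmap_def bij_betw_def)
  qed
  then show "gmap (RC_pair X X0, snd (canonical_algebra (X, X0, R))) ` carrier (RC_pair X X0) =
      image point ` carrier (RC_pair X X0)"
    by (rule image_cong[OF refl])
qed

lemma point_clan_X0: "x \<in> X0 \<Longrightarrow> point_clan X X0 x = {F \<in> carrier (CO_sub X X0). x \<in> F}"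
proof -
  assume x: "x \<in> X0"
  have "x \<in> X closure_of F \<longleftrightarrow> x \<in> F" if "F \<in> carrier (CO_sub X X0)" for F
    using closure_Int_X0[of F] that x by (auto simp: CO_simps(1))
  then show ?thesis unfolding point_clan_def by auto
qed

lemma point_clan_Ult: "x \<in> X0 \<Longrightarrow> point_clan X X0 x \<in> Ult (CO_sub X X0)"
proof -
  assume x: "x \<in> X0"
  show ?thesis
    unfolding point_clan_X0[OF x] CO.mem_Ult_iff ba_filter_def
  proof (intro conjI ballI impI)
    show "{F \<in> carrier (CO_sub X X0). x \<in> F} \<noteq> {}" using CO.one_closed x by (auto simp: CO_simps(3))
    show "F \<otimes>\<^bsub>CO_sub X X0\<^esub> G \<in> {F \<in> carrier (CO_sub X X0). x \<in> F}"
      if "F \<in> {F \<in> carrier (CO_sub X X0). x \<in> F}" "G \<in> {F \<in> carrier (CO_sub X X0). x \<in> F}" for F G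
      using that CO.m_closed[of F G] by (simp add: CO_simps(4))
    show "F \<in> {F \<in> carrier (CO_sub X X0). x \<in> F} \<or> compl (CO_sub X X0) F \<in> {F \<in> carrier (CO_sub X X0). x \<in> F}"
      if "F \<in> carrier (CO_sub X X0)" for F
      using that x CO.compl_closed[of F] by (auto simp: CO_simps(6))
  qed (auto simp: ba_le_def CO_simps(2,4))
qed

text \<open>The members of \<open>u\<close> are closed with the finite intersection property, so
  compactness of \<open>X0\<close> yields a common point \<open>x\<close>. Then \<open>u\<close> is
  contained in the ultrafilter of \<open>x\<close>, and maximality gives equality.\<close>

lemma Ult_is_point:
  assumes u: "u \<in> Ult (CO_sub X X0)" shows "u \<in> point_clan X X0 ` X0"
proof -
  have closed: "closedin T F" if "F \<in> u" for F
    using CO.Ult_subset[OF u] that by (auto simp: CO_simps(1))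
  \<comment> \<open>Intersecting with \<open>X0\<close> gives the empty family the unit of the
    clopen algebra as its value.\<close>
  have fin: "X0 \<inter> \<Inter>\<F> \<in> u" if "finite \<F>" "\<F> \<subseteq> u" for \<F>
    using that
  proof (induction \<F> rule: finite_induct)
    case empty
    then show ?case using CO.Ult_one[OF u] by (simp add: CO_simps)
  next
    case (insert F \<F>)
    have c: "F \<in> carrier (CO_sub X X0)" "X0 \<inter> \<Inter>\<F> \<in> carrier (CO_sub X X0)"
      using insert CO.Ult_subset[OF u] by auto
    have "F \<otimes>\<^bsub>CO_sub X X0\<^esub> (X0 \<inter> \<Inter>\<F>) \<in> u"
      unfolding CO.Ult_meet[OF u c] using insert by simp
    then show ?case by (simp add: CO_simps(4) Int_left_commute)
  qed
  have "\<Inter>\<F> \<noteq> {}" if "finite \<F>" "\<F> \<subseteq> u" for \<F>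
    using fin[OF that] CO.Ult_zero[OF u] by (auto simp: CO_simps(2))
  then have "\<Inter>u \<noteq> {}"
    using closed by (intro pcsD(2)[unfolded compact_space_fip, rule_format]) auto
  then obtain x where x: "x \<in> \<Inter>u" by blast
  then have "x \<in> X0" using CO.Ult_one[OF u] by (auto simp: CO_simps(3))
  then have "u \<subseteq> point_clan X X0 x" "point_clan X X0 x \<in> Ult (CO_sub X X0)"
    using x CO.Ult_subset[OF u] point_clan_Ult by (auto simp: point_clan_X0)
  then have "u = point_clan X X0 x" using u unfolding Ult_def by auto
  then show ?thesis using \<open>x \<in> X0\<close> by blast
qed

lemma point_X0: "point ` X0 = Ult (RC_pair X X0)"
proof -
  have "point_clan X X0 ` X0 = Ult (CO_sub X X0)"
    using Ult_is_point point_clan_Ult by blast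
  then show ?thesis
    unfolding cl.Ult_bij[symmetric] by (simp add: point_def[abs_def] flip: image_image)
qed

text \<open>A pair outside the closed relation \<open>R\<close> lies in an open rectangle avoiding
  it. Zero-dimensionality shrinks the sides to clopen sets, which belong to the two clans but are
  not in contact.\<close>

lemma rel_iff_point_clan:
  assumes x: "x \<in> X0" and y: "y \<in> X0"
  shows "(x, y) \<in> R \<longleftrightarrow> (point_clan X X0 x, point_clan X X0 y) \<in> ult_rel (CO_sub X X0) (rel_contact X X0 R)"
proof
  show "(x, y) \<in> R \<Longrightarrow> (point_clan X X0 x, point_clan X X0 y) \<in> ult_rel (CO_sub X X0) (rel_contact X X0 R)"
    using point_clan_Ult x y by (auto simp: ult_rel_def point_clan_X0 rel_contact_def)
  assume *: "(point_clan X X0 x, point_clan X X0 y) \<in> ult_rel (CO_sub X X0) (rel_contact X X0 R)"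
  show "(x, y) \<in> R"
  proof (rule ccontr)
    assume "(x, y) \<notin> R"
    then have "(x, y) \<in> X0 \<times> X0 - R" using x y by simp
    moreover have "openin (prod_topology T T) (X0 \<times> X0 - R)"
      using pcsD(5) topspace_X0 unfolding closedin_def topspace_prod_topology by metis
    ultimately obtain U V where UV: "openin T U" "openin T V" "x \<in> U" "y \<in> V" "U \<times> V \<subseteq> X0 \<times> X0 - R"
      unfolding openin_prod_topology_alt by metis
    obtain F where F: "openin T F" "closedin T F" "x \<in> F" "F \<subseteq> U"
      using pcsD(4) UV(1,3) unfolding zero_dimensional_def by metis
    obtain G where G: "openin T G" "closedin T G" "y \<in> G" "G \<subseteq> V"
      using pcsD(4) UV(2,4) unfolding zero_dimensional_def by metis
    have "F \<in> point_clan X X0 x" "G \<in> point_clan X X0 y"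
      using F G x y by (auto simp: point_clan_X0 CO_simps(1))
    then have "(F, G) \<in> rel_contact X X0 R" using * by (auto simp: ult_rel_def)
    then show False using UV(5) F(4) G(4) by (auto simp: rel_contact_def)
  qed
qed

lemma point_pcs_iso:
  "point \<in> pcs_iso (X, X0, R) (canonical_space (canonical_algebra (X, X0, R)))"
proof -
  have "(x, y) \<in> R \<longleftrightarrow> (point x, point y) \<in> ult_rel (RC_pair X X0) (snd (canonical_algebra (X, X0, R)))"
    if "x \<in> X0" "y \<in> X0" for x y
    using rel_iff_point_clan[OF that] cl.ult_rel_image[OF point_clan_Ult point_clan_Ult, of x y] that
    by (simp add: point_def del: canonical_algebra.simps)
  moreover have "canonical_space (canonical_algebra (X, X0, R)) =
      (clan_topology (RC_pair X X0, snd (canonical_algebra (X, X0, R))), Ult (RC_pair X X0),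
        ult_rel (RC_pair X X0) (snd (canonical_algebra (X, X0, R))))"
    by (simp only: canonical_algebra.simps canonical_space_eq snd_conv)
  ultimately show ?thesis
    using point_homeomorphic point_X0 by (simp only: pcs_iso.simps mem_Collect_eq) blast
qed

lemma precontact_canonical_algebra: "precontact_algebra (canonical_algebra (X, X0, R))"
  using cl.precontact_image by (simp only: precontact_algebra_iff canonical_algebra.simps snd_conv)

text \<open>\<open>point_homeomorphic\<close> moves connectedness to the space of clans, where
  \<open>connected_iff\<close> applies.\<close>

lemma connected_canonical_algebra:
  "pcs_connected (X, X0, R) \<longleftrightarrow> Ccon (canonical_algebra (X, X0, R))"
proof -
  have "Ccon (RC_pair X X0, snd (canonical_algebra (X, X0, R))) \<longleftrightarrow> connected_space X"
    using clan.connected_iff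
      homeomorphic_connected_space[OF homeomorphic_map_imp_homeomorphic_space[OF point_homeomorphic]] by blast
  then show ?thesis by (simp only: pcs_connected.simps canonical_algebra.simps snd_conv)
qed

end

section \<open>Isomorphism classes and the bijective correspondence\<close>

lemma pc_spaceI: "precontact_space (X, X0, R) \<Longrightarrow> pc_space X X0 R"
  by (intro pc_space.intro top_pair.intro pc_space_axioms.intro) simp

lemma pcs_isomorphic_trans:
  "pcs_isomorphic S S' \<Longrightarrow> pcs_isomorphic S' S'' \<Longrightarrow> pcs_isomorphic S S''"
proof -
  obtain X X0 R Y Y0 Q Z Z0 P where S: "S = (X, X0, R)" "S' = (Y, Y0, Q)" "S'' = (Z, Z0, P)"
    by (metis prod_cases3)
  assume "pcs_isomorphic S S'" "pcs_isomorphic S' S''"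
  then obtain f f' where "f \<in> pcs_iso S S'" "f' \<in> pcs_iso S' S''" by (auto simp: pcs_isomorphic_def)
  then have "f' \<circ> f \<in> pcs_iso S S''"
    by (auto simp: S homeomorphic_map_compose image_comp)
  then show ?thesis by (auto simp: pcs_isomorphic_def)
qed

lemma pcs_isomorphic_sym:
  assumes "precontact_space S" "pcs_isomorphic S S'" shows "pcs_isomorphic S' S"
proof -
  obtain X X0 R Y Y0 Q where S: "S = (X, X0, R)" "S' = (Y, Y0, Q)" by (metis prod_cases3)
  interpret X: pc_space X X0 R using assms(1) S pc_spaceI by blast
  obtain f where f: "f \<in> pcs_iso S S'" using assms(2) by (auto simp: pcs_isomorphic_def)
  then have "homeomorphic_map X Y f" by (simp add: S)
  then obtain k where k: "homeomorphic_maps X Y f k" by (auto simp: homeomorphic_map_maps)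
  then have kf: "k (f x) = x" if "x \<in> X0" for x using that X.subspace by (auto simp: homeomorphic_maps_def)
  have "homeomorphic_map Y X k" using k by (simp add: homeomorphic_maps_map)
  moreover have Y0: "Y0 = f ` X0" using f by (auto simp: S)
  then have "k ` Y0 = X0" using kf by (simp add: image_image)
  moreover have "(x, y) \<in> Q \<longleftrightarrow> (k x, k y) \<in> R" if xy: "x \<in> Y0" "y \<in> Y0" for x y
  proof -
    obtain x' y' where "x' \<in> X0" "x = f x'" "y' \<in> X0" "y = f y'" using xy unfolding Y0 by (elim imageE)
    then show ?thesis using f kf by (simp add: S)
  qed
  ultimately have "k \<in> pcs_iso S' S" by (simp add: S)
  then show ?thesis by (auto simp: pcs_isomorphic_def)
qed

lemma pca_isomorphic_canonical_algebra:
  assumes "precontact_space S" "precontact_space S'" "pcs_isomorphic S S'"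
  shows "pca_isomorphic (canonical_algebra S) (canonical_algebra S')"
proof -
  obtain X X0 R Y Y0 Q where S: "S = (X, X0, R)" "S' = (Y, Y0, Q)" by (metis prod_cases3)
  obtain f where f: "f \<in> pcs_iso (X, X0, R) (Y, Y0, Q)"
    using assms(3) by (auto simp: pcs_isomorphic_def S)
  show ?thesis
    unfolding S by (rule pcs_isomorphic_canonical_algebra[OF _ _ f]) (use assms(1,2) S in simp_all)
qed

lemma canonical_algebra_of_space:
  assumes "precontact_space S"
  shows "precontact_algebra (canonical_algebra S)" "pcs_isomorphic S (canonical_space (canonical_algebra S))"
    "pcs_connected S \<longleftrightarrow> Ccon (canonical_algebra S)"
proof -
  obtain X X0 R where S: "S = (X, X0, R)" by (metis prod_cases3)
  interpret pc_space X X0 R using assms S pc_spaceI by blast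
  show "precontact_algebra (canonical_algebra S)" "pcs_isomorphic S (canonical_space (canonical_algebra S))"
    "pcs_connected S \<longleftrightarrow> Ccon (canonical_algebra S)"
    using precontact_canonical_algebra point_pcs_iso connected_canonical_algebra
    unfolding S pcs_isomorphic_def by blast+
qed

lemma canonical_space_of_algebra:
  assumes "precontact_algebra A"
  shows "precontact_space (canonical_space A)" "pca_isomorphic A (canonical_algebra (canonical_space A))"
    "Ccon A \<longleftrightarrow> pcs_connected (canonical_space A)"
proof -
  obtain B C where A: "A = (B, C)" by fastforce
  interpret clan_space B C "clan_topology (B, C)" "gmap (B, C)"
    using assms unfolding A precontact_algebra_iff by (rule clan_space.intro)
  show "precontact_space (canonical_space A)" "pca_isomorphic A (canonical_algebra (canonical_space A))"
    "Ccon A \<longleftrightarrow> pcs_connected (canonical_space A)"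
    using precontact_space g_iso connected_iff
    unfolding A canonical_space_eq pca_isomorphic_def pcs_connected.simps by blast+
qed

lemma canonical_space_properties:
  assumes "precontact_algebra (B, C)" "canonical_space (B, C) = (X, X0, R)"
  shows "gmap (B, C) \<in> pca_iso (B, C) (canonical_algebra (X, X0, R))"
    "contact_algebra (B, sharp (B, C))"
    "contact_algebra (RC_pair X X0, pair_contact X X0)"
    "gmap (B, C) \<in> pca_iso (B, sharp (B, C)) (RC_pair X X0, pair_contact X X0)"
    "carrier (RC X) = carrier (RC_pair X X0) \<longleftrightarrow> ba_complete B"
    "Cref (B, C) \<longleftrightarrow> pcs_reflexive (X, X0, R)"
    "Csym (B, C) \<longleftrightarrow> pcs_symmetric (X, X0, R)"
    "Ctr (B, C) \<longleftrightarrow> pcs_transitive (X, X0, R)"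
    "Ccon (B, C) \<longleftrightarrow> pcs_connected (X, X0, R)"
proof -
  have eq: "X = clan_topology (B, C)" "X0 = Ult B" "R = ult_rel B C"
    using assms(2) unfolding canonical_space_eq by auto
  interpret clan_space B C "clan_topology (B, C)" "gmap (B, C)"
    using assms(1) unfolding precontact_algebra_iff by (rule clan_space.intro)
  note facts = g_iso contact_algebra_sharp contact_algebra_RC_pair g_sharp_iso complete_iff
    Cref_iff Csym_iff Ctr_iff connected_iff
  show "gmap (B, C) \<in> pca_iso (B, C) (canonical_algebra (X, X0, R))"
    "contact_algebra (B, sharp (B, C))"
    "contact_algebra (RC_pair X X0, pair_contact X X0)"
    "gmap (B, C) \<in> pca_iso (B, sharp (B, C)) (RC_pair X X0, pair_contact X X0)"
    "carrier (RC X) = carrier (RC_pair X X0) \<longleftrightarrow> ba_complete B"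
    "Cref (B, C) \<longleftrightarrow> pcs_reflexive (X, X0, R)"
    "Csym (B, C) \<longleftrightarrow> pcs_symmetric (X, X0, R)"
    "Ctr (B, C) \<longleftrightarrow> pcs_transitive (X, X0, R)"
    "Ccon (B, C) \<longleftrightarrow> pcs_connected (X, X0, R)"
    unfolding eq pcs_reflexive.simps pcs_symmetric.simps pcs_transitive.simps pcs_connected.simps
    by (rule facts)+
qed

text \<open>Isomorphic spaces have isomorphic canonical algebras, and each algebra is isomorphic to
  that of its own space; the chain joins \<open>A\<close> to \<open>A'\<close>. On isomorphism
  classes this says that the assignment is well defined and injective.\<close>

lemma pca_isomorphic_iff:
  assumes A: "precontact_algebra A" and A': "precontact_algebra A'"
  shows "pca_isomorphic A A' \<longleftrightarrow> pcs_isomorphic (canonical_space A) (canonical_space A')"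
proof
  assume "pcs_isomorphic (canonical_space A) (canonical_space A')"
  then have "pca_isomorphic (canonical_algebra (canonical_space A)) (canonical_algebra (canonical_space A'))"
    by (rule pca_isomorphic_canonical_algebra[OF canonical_space_of_algebra(1)[OF A]
          canonical_space_of_algebra(1)[OF A']])
  moreover have "pca_isomorphic (canonical_algebra (canonical_space A')) A'"
    by (rule pca_isomorphic_sym[OF A' canonical_algebra_of_space(1)[OF canonical_space_of_algebra(1)[OF A']]
          canonical_space_of_algebra(2)[OF A']])
  ultimately show "pca_isomorphic A A'"
    using canonical_space_of_algebra(2)[OF A] pca_isomorphic_trans by metis
qed (rule pcs_isomorphic_canonical_space[OF A A'])

text \<open>The dual chain, through the canonical spaces of the canonical algebras.\<close>

lemma pcs_isomorphic_iff:
  assumes S: "precontact_space S" and S': "precontact_space S'"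
  shows "pcs_isomorphic S S' \<longleftrightarrow> pca_isomorphic (canonical_algebra S) (canonical_algebra S')"
proof
  assume "pca_isomorphic (canonical_algebra S) (canonical_algebra S')"
  then have "pcs_isomorphic (canonical_space (canonical_algebra S)) (canonical_space (canonical_algebra S'))"
    by (rule pcs_isomorphic_canonical_space[OF canonical_algebra_of_space(1)[OF S]
          canonical_algebra_of_space(1)[OF S']])
  moreover have "pcs_isomorphic (canonical_space (canonical_algebra S')) S'"
    by (rule pcs_isomorphic_sym[OF S' canonical_algebra_of_space(2)[OF S']])
  ultimately show "pcs_isomorphic S S'"
    using canonical_algebra_of_space(2)[OF S] pcs_isomorphic_trans by metis
qed (rule pca_isomorphic_canonical_algebra[OF S S'])

text \<open>Isomorphism classes range over structures on different types, so the bijection is stated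
  through representatives: both assignments preserve and reflect isomorphism, both round trips
  return an isomorphic structure, and connectedness is kept on either side.\<close>

theorem theorem6p1:
  shows "(\<forall>(B :: 'a boolalg) C X X0 R.
        precontact_algebra (B, C) \<and> canonical_space (B, C) = (X, X0, R) \<longrightarrow>
          gmap (B, C) \<in> pca_iso (B, C) (canonical_algebra (X, X0, R)) \<and>
          contact_algebra (B, sharp (B, C)) \<and>
          contact_algebra (RC_pair X X0, pair_contact X X0) \<and>
          gmap (B, C) \<in> pca_iso (B, sharp (B, C)) (RC_pair X X0, pair_contact X X0) \<and>
          (carrier (RC X) = carrier (RC_pair X X0) \<longleftrightarrow> ba_complete B) \<and>
          (Cref (B, C) \<longleftrightarrow> pcs_reflexive (X, X0, R)) \<and>
          (Csym (B, C) \<longleftrightarrow> pcs_symmetric (X, X0, R)) \<and>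
          (Ctr (B, C) \<longleftrightarrow> pcs_transitive (X, X0, R)) \<and>
          (Ccon (B, C) \<longleftrightarrow> pcs_connected (X, X0, R)))
    \<and> (\<forall>A :: 'a precontact. precontact_algebra A \<longrightarrow>
          precontact_space (canonical_space A) \<and>
          pca_isomorphic A (canonical_algebra (canonical_space A)) \<and>
          (Ccon A \<longleftrightarrow> pcs_connected (canonical_space A)))
    \<and> (\<forall>S :: 'x pcspace. precontact_space S \<longrightarrow>
          precontact_algebra (canonical_algebra S) \<and>
          pcs_isomorphic S (canonical_space (canonical_algebra S)) \<and>
          (pcs_connected S \<longleftrightarrow> Ccon (canonical_algebra S)))
    \<and> (\<forall>(A :: 'a precontact) (A' :: 'b precontact).
          precontact_algebra A \<and> precontact_algebra A' \<longrightarrow>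
          (pca_isomorphic A A' \<longleftrightarrow>
           pcs_isomorphic (canonical_space A) (canonical_space A')))
    \<and> (\<forall>(S :: 'x pcspace) (S' :: 'y pcspace).
          precontact_space S \<and> precontact_space S' \<longrightarrow>
          (pcs_isomorphic S S' \<longleftrightarrow>
           pca_isomorphic (canonical_algebra S) (canonical_algebra S')))"
  by (intro conjI allI impI; (elim conjE)?)
    (assumption | rule canonical_space_properties canonical_space_of_algebra canonical_algebra_of_space
      pca_isomorphic_iff pcs_isomorphic_iff)+

end
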